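(* Let $f(\mathbf z)=\sum_{\nu}c_\nu\mathbf z^\nu$ be a convergent power series in $\mathbf z=(z_1,\dots,z_n)$ with $f(\mathbf 0)=0$ which is non-degenerate and convenient, and let $B:=\max\{b_1,\dots,b_n\}$, where $\Gamma(f)$ meets the $\nu_j$-axis at the point $b_je_j$. Then the Łojasiewicz exponent satisfies $\ell_0(f)\le B-1$. Furthermore, if some Łojasiewicz monomial $z_i^{B}$ of $f$ is not Łojasiewicz exceptional, then $\ell_0(f)=B-1$.
   Context: The Newton diagram $\Gamma_+(f)$ is the convex hull of $\bigcup_{c_\nu\neq 0}(\nu+\mathbb R_{\ge 0}^n)$ and the Newton boundary $\Gamma(f)$ is the union of the compact faces of $\Gamma_+(f)$. For a weight vector $P=(p_1,\dots,p_n)\in\mathbb R_{\ge0}^n$, let $d(P,f)=\min\{\sum_ip_i\nu_i:\nu\in\Gamma_+(f)\}$, $\Delta(P,f)$ the face of $\Gamma_+(f)$ on which this minimum is attained, and $f_P=\sum_{\nu\in\Delta(P,f)}c_\nu\mathbf z^\nu$ the face function. $P$ is strictly positive if all $p_i>0$. $f$ is non-degenerate if for every strictly positive $P$ the polynomial $f_P$ has no critical point in $(\mathbb C^* )^n$. $f$ is convenient if for every $j=1,\dots,n$ the Newton boundary $\Gamma(f)$ meets the $\nu_j$-axis, at a point $b_je_j$ ($e_j$ the $j$-th standard basis vector). A Łojasiewicz monomial is a monomial $z_i^{B}$ with $b_i=B$. A Łojasiewicz monomial $z_i^B$ is Łojasiewicz exceptional if there exist $j\neq i$ and an integer $B'<B-1$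 such that the monomial $z_jz_i^{B'}$ has a non-zero coefficient in $f$. With $\partial f=(\partial f/\partial z_1,\dots,\partial f/\partial z_n)$, the Łojasiewicz exponent $\ell_0(f)$ is the infimum of the numbers $\theta>0$ for which there are $c>0$ and a neighbourhood $U$ of $\mathbf 0$ with $\|\partial f(\mathbf z)\|\ge c\|\mathbf z\|^\theta$ for all $\mathbf z\in U$. *)

theory Defs
  imports "HOL-Analysis.Analysis"
begin

definition monom :: "complex ^ 'n::finite \<Rightarrow> ('n \<Rightarrow> nat) \<Rightarrow> complex" where
  "monom z \<nu> = (\<Prod>i\<in>UNIV. (z $ i) ^ (\<nu> i))"

definition convergent_ps :: "(('n::finite \<Rightarrow> nat) \<Rightarrow> complex) \<Rightarrow> bool" where
  "convergent_ps c \<longleftrightarrow> (\<exists>r>0. \<forall>z::complex^'n. norm z < r \<longrightarrow>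
      (\<lambda>\<nu>. norm (c \<nu> * monom z \<nu>)) summable_on UNIV)"

definition ps_fun :: "(('n::finite \<Rightarrow> nat) \<Rightarrow> complex) \<Rightarrow> complex ^ 'n \<Rightarrow> complex" where
  "ps_fun c z = (\<Sum>\<^sub>\<infinity>\<nu>. c \<nu> * monom z \<nu>)"

definition pdiff :: "(complex ^ 'n::finite \<Rightarrow> complex) \<Rightarrow> 'n \<Rightarrow> complex ^ 'n \<Rightarrow> complex" where
  "pdiff g i z = deriv (\<lambda>w. g (\<chi> j. if j = i then w else z $ j)) (z $ i)"

definition grad :: "(complex ^ 'n::finite \<Rightarrow> complex) \<Rightarrow> complex ^ 'n \<Rightarrow> complex ^ 'n" where
  "grad g z = (\<chi> i. pdiff g i z)"

text \<open>Lojasiewicz exponent, as an extended real (infimum of the empty set is +infinity).\<close>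
definition loj_set :: "(complex ^ 'n::finite \<Rightarrow> complex) \<Rightarrow> real set" where
  "loj_set g = {\<theta>. \<theta> > 0 \<and> (\<exists>C>0. eventually
      (\<lambda>z. norm (grad g z) \<ge> C * norm z powr \<theta>) (nhds 0))}"

definition loj_exp :: "(complex ^ 'n::finite \<Rightarrow> complex) \<Rightarrow> ereal" where
  "loj_exp g = Inf (ereal ` loj_set g)"

definition nu_vec :: "('n::finite \<Rightarrow> nat) \<Rightarrow> real ^ 'n" where
  "nu_vec \<nu> = (\<chi> i. real (\<nu> i))"

definition newton_diagram :: "(('n::finite \<Rightarrow> nat) \<Rightarrow> complex) \<Rightarrow> (real ^ 'n) set" where
  "newton_diagram c = convex hull
     (\<Union>\<nu>\<in>{\<nu>. c \<nu> \<noteq> 0}. {x. \<forall>i. x $ i \<ge> real (\<nu> i)})"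

definition newton_boundary :: "(('n::finite \<Rightarrow> nat) \<Rightarrow> complex) \<Rightarrow> (real ^ 'n) set" where
  "newton_boundary c = \<Union>{F. F face_of newton_diagram c \<and> compact F}"

definition dPf :: "real ^ 'n::finite \<Rightarrow> (('n \<Rightarrow> nat) \<Rightarrow> complex) \<Rightarrow> real" where
  "dPf P c = Inf ((\<lambda>x. P \<bullet> x) ` newton_diagram c)"

definition DeltaPf :: "real ^ 'n::finite \<Rightarrow> (('n \<Rightarrow> nat) \<Rightarrow> complex) \<Rightarrow> (real ^ 'n) set" where
  "DeltaPf P c = {x \<in> newton_diagram c. P \<bullet> x = dPf P c}"

definition face_fun :: "(('n::finite \<Rightarrow> nat) \<Rightarrow> complex) \<Rightarrow> real ^ 'n \<Rightarrow> complex ^ 'n \<Rightarrow> complex" where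
  "face_fun c P z = (\<Sum>\<nu>\<in>{\<nu>. c \<nu> \<noteq> 0 \<and> nu_vec \<nu> \<in> DeltaPf P c}. c \<nu> * monom z \<nu>)"

definition non_degenerate :: "(('n::finite \<Rightarrow> nat) \<Rightarrow> complex) \<Rightarrow> bool" where
  "non_degenerate c \<longleftrightarrow> (\<forall>P::real^'n. (\<forall>i. P $ i > 0) \<longrightarrow>
      \<not> (\<exists>z. (\<forall>i. z $ i \<noteq> 0) \<and> grad (face_fun c P) z = 0))"

definition convenient :: "(('n::finite \<Rightarrow> nat) \<Rightarrow> complex) \<Rightarrow> bool" where
  "convenient c \<longleftrightarrow> (\<forall>j. \<exists>t. t *\<^sub>R axis j 1 \<in> newton_boundary c)"

definition loj_exceptional :: "(('n::finite \<Rightarrow> nat) \<Rightarrow> complex) \<Rightarrow> real \<Rightarrow> 'n \<Rightarrow> bool" where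
  "loj_exceptional c B i \<longleftrightarrow> (\<exists>j (B'::nat). j \<noteq> i \<and> real B' < B - 1 \<and>
      c (\<lambda>k. if k = j then 1 else if k = i then B' else 0) \<noteq> 0)"

end

theory Submission
  imports "HOL-Complex_Analysis.Cauchy_Integral_Formula" Defs
begin

text \<open>
  Curve selection is replaced by a compactness argument on the finitely many monomials of degree
  at most \<open>B\<close>. Suppose that along some sequence in the torus tending to \<open>0\<close> all Euler
  derivatives \<open>z\<^sub>i \<partial>f/\<partial>z\<^sub>i\<close> are negligible against the largest monomial.
  After passing to a subsequence all ratios of monomials to the largest one converge; the monomials
  with nonzero limit ratio are exactly those of a face function \<open>f\<^sub>P\<close> with \<open>P\<close> strictly
  positive, and the limit ratios come from a point of the torus at which \<open>f\<^sub>P\<close> is critical,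
  contradicting non-degeneracy. So some Euler derivative is at least a constant times
  \<open>max\<^sub>j |z\<^sub>j|\<^sup>B\<close>, on the torus and by density near \<open>0\<close>; dividing by
  \<open>max\<^sub>j |z\<^sub>j|\<close> gives the bound \<open>B - 1\<close>. No restriction to coordinate subspaces is
  needed. The converse bound is read off on the \<open>z\<^sub>i\<close>-axis, where a non-exceptional
  monomial forces every partial derivative to vanish to order \<open>B - 1\<close>.
\<close>

subsection \<open>Power series and their partial derivatives\<close>

definition tdeg :: "('n::finite \<Rightarrow> nat) \<Rightarrow> nat" where
  "tdeg \<nu> = sum \<nu> UNIV"

definition axis_exp :: "'n \<Rightarrow> nat \<Rightarrow> 'n \<Rightarrow> nat" where
  "axis_exp j k = (\<lambda>l. if l = j then k else 0)"

text \<open>The partial derivative of the monomial in direction \<open>i\<close>, with the power of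
  \<open>z $ i\<close> split off rather than divided out, so that it is correct at
  \<open>z $ i = 0\<close>. If \<open>\<nu> i = 0\<close>, the truncated exponent is harmless
  because the leading factor vanishes.\<close>

definition dmonom :: "complex ^ 'n::finite \<Rightarrow> ('n \<Rightarrow> nat) \<Rightarrow> 'n \<Rightarrow> complex" where
  "dmonom z \<nu> i = of_nat (\<nu> i) * z $ i ^ (\<nu> i - 1) * (\<Prod>j\<in>UNIV - {i}. z $ j ^ \<nu> j)"

text \<open>The operator \<open>z_i d/dz_i\<close> applied to the part of the series supported on
  \<open>S\<close>. It multiplies each monomial by an exponent, so its values are comparable with
  the monomials themselves.\<close>

definition euler_sum ::
    "(('n::finite \<Rightarrow> nat) \<Rightarrow> complex) \<Rightarrow> ('n \<Rightarrow> nat) set \<Rightarrow> 'n \<Rightarrow> complex ^ 'n \<Rightarrow> complex" where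
  "euler_sum c S i z = (\<Sum>\<nu>\<in>S. of_nat (\<nu> i) * c \<nu> * monom z \<nu>)"

lemma monom_axis_exp: "monom z (axis_exp j k) = z $ j ^ k"
proof -
  have "monom z (axis_exp j k) = (\<Prod>i\<in>UNIV. if i = j then z $ j ^ k else 1)"
    unfolding monom_def axis_exp_def by (intro prod.cong) auto
  thus ?thesis by simp
qed

lemma tdeg_axis_exp: "tdeg (axis_exp j k) = k"
  by (simp add: tdeg_def axis_exp_def)

lemma monom_split: "monom z \<nu> = z $ i ^ \<nu> i * (\<Prod>j\<in>UNIV - {i}. z $ j ^ \<nu> j)"
  unfolding monom_def by (subst prod.remove[of UNIV i]) auto

lemma tdeg_split: "tdeg \<nu> = \<nu> i + (\<Sum>j\<in>UNIV - {i}. \<nu> j)"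
  unfolding tdeg_def by (subst sum.remove[of UNIV i]) auto

lemma le_tdeg: "\<nu> i \<le> tdeg \<nu>"
  using tdeg_split[of \<nu> i] by simp

lemma monom_nonzero: "(\<And>i. z $ i \<noteq> 0) \<Longrightarrow> monom z \<nu> \<noteq> 0"
  by (simp add: monom_def)

lemma mult_dmonom: "z $ i * dmonom z \<nu> i = of_nat (\<nu> i) * monom z \<nu>"
  by (cases "\<nu> i") (simp_all add: dmonom_def monom_split[of z \<nu> i])

lemma norm_monom_le:
  assumes "\<And>j. norm (z $ j) \<le> s"
  shows "norm (monom z \<nu>) \<le> s ^ tdeg \<nu>"
proof -
  have "norm (monom z \<nu>) = (\<Prod>j\<in>UNIV. norm (z $ j) ^ \<nu> j)"
    by (simp add: monom_def prod_norm [symmetric] norm_power)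
  also have "\<dots> \<le> (\<Prod>j\<in>UNIV. s ^ \<nu> j)"
    by (intro prod_mono) (auto intro!: power_mono assms)
  finally show ?thesis by (simp add: tdeg_def power_sum)
qed

lemma norm_dmonom_le:
  assumes "\<And>j. norm (z $ j) \<le> s"
  shows "norm (dmonom z \<nu> i) \<le> real (\<nu> i) * s ^ (tdeg \<nu> - 1)"
proof (cases "\<nu> i")
  case (Suc m)
  have s: "s \<ge> 0" using assms[of i] norm_ge_zero order_trans by blast
  have "norm (dmonom z \<nu> i)
      = real (\<nu> i) * (norm (z $ i) ^ m * (\<Prod>j\<in>UNIV - {i}. norm (z $ j) ^ \<nu> j))"
    by (simp add: dmonom_def prod_norm [symmetric] norm_power norm_mult Suc del: of_nat_Suc)
  also have "\<dots> \<le> real (\<nu> i) * (s ^ m * (\<Prod>j\<in>UNIV - {i}. s ^ \<nu> j))"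
  proof (intro mult_left_mono mult_mono)
    show "(\<Prod>j\<in>UNIV - {i}. norm (z $ j) ^ \<nu> j) \<le> (\<Prod>j\<in>UNIV - {i}. s ^ \<nu> j)"
      by (rule prod_mono) (simp add: power_mono assms)
  qed (use s in \<open>auto intro: power_mono assms prod_nonneg\<close>)
  also have "s ^ m * (\<Prod>j\<in>UNIV - {i}. s ^ \<nu> j) = s ^ (tdeg \<nu> - 1)"
    by (simp add: tdeg_split[of \<nu> i] Suc power_add power_sum)
  finally show ?thesis .
qed (simp add: dmonom_def)

lemma has_field_derivative_monom:
  "((\<lambda>w. monom (\<chi> j. if j = i then w else z $ j) \<nu>) has_field_derivative
     dmonom (\<chi> j. if j = i then w else z $ j) \<nu> i) (at w)"
proof -
  have [simp]: "(\<Prod>j\<in>UNIV - {i}. (if j = i then u else z $ j) ^ \<nu> j) = (\<Prod>j\<in>UNIV - {i}. z $ j ^ \<nu> j)" for u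
    by (intro prod.cong) auto
  show ?thesis
    unfolding monom_split[of _ \<nu> i] dmonom_def
    by (auto intro!: derivative_eq_intros)
qed

lemma vec_upd_self: "(\<chi> j. if j = i then z $ i else z $ j) = z"
  by (simp add: vec_eq_iff)

lemma pdiff_sum_monom:
  assumes "finite S"
  shows "pdiff (\<lambda>z. \<Sum>\<nu>\<in>S. c \<nu> * monom z \<nu>) i z = (\<Sum>\<nu>\<in>S. c \<nu> * dmonom z \<nu> i)"
  unfolding pdiff_def
  by (rule DERIV_imp_deriv, subst (2) vec_upd_self[of i z, symmetric])
     (intro DERIV_sum DERIV_cmult has_field_derivative_monom)

section \<open>Majorants and termwise differentiation near the origin\<close>

text \<open>Absolute convergence at one diagonal point majorises the series on a whole polydisc.
  Halving the radius absorbs the factor \<open>tdeg \<nu>\<close> that differentiation brings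
  in.\<close>

lemma convergent_ps_radius:
  fixes c :: "('n::finite \<Rightarrow> nat) \<Rightarrow> complex"
  assumes "convergent_ps c"
  obtains \<rho> where "\<rho> > 0" "(\<lambda>\<nu>. norm (c \<nu>) * \<rho> ^ tdeg \<nu>) summable_on UNIV"
    "(\<lambda>\<nu>. norm (c \<nu>) * (real (tdeg \<nu>) * \<rho> ^ (tdeg \<nu> - 1))) summable_on UNIV"
proof -
  from assms obtain r where r: "r > 0"
    "\<And>z::complex^'n. norm z < r \<Longrightarrow> (\<lambda>\<nu>. norm (c \<nu> * monom z \<nu>)) summable_on UNIV"
    unfolding convergent_ps_def by blast
  \<comment> \<open>The Euclidean norm is at most the sum of the moduli, so the diagonal point
    \<open>z0\<close> has norm at most \<open>r / 2\<close>.\<close>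
  define \<sigma> where "\<sigma> = r / (2 * real CARD('n))"
  have \<sigma>: "\<sigma> > 0" using r by (simp add: \<sigma>_def)
  define z0 :: "complex^'n" where "z0 = (\<chi> j. of_real \<sigma>)"
  have "norm z0 \<le> (\<Sum>j\<in>(UNIV::'n set). norm (z0 $ j))"
    by (simp add: norm_vec_def L2_set_le_sum)
  also have "\<dots> = real CARD('n) * \<sigma>" using \<sigma> by (simp add: z0_def)
  also have "\<dots> = r / 2" by (simp add: \<sigma>_def)
  finally have "norm z0 < r" using r by simp
  moreover have "norm (c \<nu> * monom z0 \<nu>) = norm (c \<nu>) * \<sigma> ^ tdeg \<nu>" for \<nu>
    using \<sigma> by (simp add: norm_mult monom_def z0_def tdeg_def power_sum flip: prod_norm of_real_power)
  ultimately have sum: "(\<lambda>\<nu>. norm (c \<nu>) * \<sigma> ^ tdeg \<nu>) summable_on UNIV"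
    using r(2)[of z0] by simp
  define \<rho> where "\<rho> = \<sigma> / 2"
  \<comment> \<open>Uses \<open>m \<le> 2 ^ m\<close>; the powers of two come from
    \<open>\<rho> = \<sigma> / 2\<close>.\<close>
  have le: "real m * \<rho> ^ (m - 1) \<le> (2 / \<sigma>) * \<sigma> ^ m" for m
  proof (cases m)
    case (Suc k)
    have "real (Suc k) \<le> 2 * 2 ^ k"
      using of_nat_mono[OF less_exp[of "Suc k", THEN less_imp_le], where 'a=real] by simp
    hence "real (Suc k) * (\<sigma> ^ k / 2 ^ k) \<le> 2 * 2 ^ k * (\<sigma> ^ k / 2 ^ k)"
      using \<sigma> by (intro mult_right_mono) auto
    thus ?thesis using \<sigma> by (simp add: Suc \<rho>_def power_divide)
  qed (use \<sigma> in simp)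
  show thesis
  proof
    show "\<rho> > 0" using \<sigma> by (simp add: \<rho>_def)
    show "(\<lambda>\<nu>. norm (c \<nu>) * \<rho> ^ tdeg \<nu>) summable_on UNIV"
      using \<sigma> by (intro summable_on_comparison_test[OF sum]) (auto simp: \<rho>_def intro!: mult_left_mono power_mono)
    have "(\<lambda>\<nu>. 2 / \<sigma> * (norm (c \<nu>) * \<sigma> ^ tdeg \<nu>)) summable_on UNIV"
      by (intro summable_on_cmult_right sum)
    thus "(\<lambda>\<nu>. norm (c \<nu>) * (real (tdeg \<nu>) * \<rho> ^ (tdeg \<nu> - 1))) summable_on UNIV"
    proof (rule summable_on_comparison_test)
      fix \<nu>
      show "norm (c \<nu>) * (real (tdeg \<nu>) * \<rho> ^ (tdeg \<nu> - 1)) \<le> 2 / \<sigma> * (norm (c \<nu>) * \<sigma> ^ tdeg \<nu>)"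
        using mult_left_mono[OF le[of "tdeg \<nu>"], of "norm (c \<nu>)"] by (simp add: mult_ac)
      show "0 \<le> norm (c \<nu>) * (real (tdeg \<nu>) * \<rho> ^ (tdeg \<nu> - 1))"
        using \<sigma> by (simp add: \<rho>_def)
    qed
  qed
qed

text \<open>In the single variable \<open>z $ i\<close> the M-test makes the partial sums converge
  uniformly on a disc, and uniform limits of holomorphic functions may be differentiated termwise.
  Convergence along finite sets of exponents is exactly unordered summation.\<close>

lemma pdiff_ps_fun:
  assumes sum: "(\<lambda>\<nu>. norm (c \<nu>) * \<rho> ^ tdeg \<nu>) summable_on UNIV"
    and z: "\<And>j. norm (z $ j) < \<rho>"
  shows "pdiff (ps_fun c) i z = (\<Sum>\<^sub>\<infinity>\<nu>. c \<nu> * dmonom z \<nu> i)"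
proof -
  define Z where "Z w = (\<chi> j. if j = i then w else z $ j)" for w
  \<comment> \<open>Half the distance from \<open>z $ i\<close> to the circle of radius
    \<open>\<rho>\<close>, so that the closed disc stays inside the polydisc.\<close>
  define e where "e = (\<rho> - norm (z $ i)) / 2"
  have e: "e > 0" using z[of i] by (simp add: e_def)
  have Zb: "norm (Z w $ j) \<le> \<rho>" if "w \<in> cball (z $ i) e" for w j
  proof -
    have "norm w \<le> norm (z $ i) + norm (w - z $ i)" by (rule norm_triangle_sub)
    also have "\<dots> \<le> norm (z $ i) + e" using that by (simp add: dist_norm norm_minus_commute)
    also have "\<dots> \<le> \<rho>" using z[of i] by (simp add: e_def field_simps)
    finally show ?thesis using z[of j] by (simp add: Z_def)
  qed
  have ul: "uniform_limit (cball (z $ i) e) (\<lambda>X w. \<Sum>\<nu>\<in>X. c \<nu> * monom (Z w) \<nu>)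
      (\<lambda>w. ps_fun c (Z w)) (finite_subsets_at_top UNIV)"
    unfolding ps_fun_def
    by (rule Weierstrass_m_test_general[OF _ sum])
       (auto simp: norm_mult intro!: mult_left_mono norm_monom_le Zb)
  have der: "((\<lambda>w. \<Sum>\<nu>\<in>X. c \<nu> * monom (Z w) \<nu>) has_field_derivative
      (\<Sum>\<nu>\<in>X. c \<nu> * dmonom (Z w) \<nu> i)) (at w)" for X w
    unfolding Z_def by (intro DERIV_sum DERIV_cmult has_field_derivative_monom)
  obtain g' where g': "\<And>w. w \<in> ball (z $ i) e \<Longrightarrow>
      ((\<lambda>w. ps_fun c (Z w)) has_field_derivative (g' w)) (at w) \<and>
      ((\<lambda>X. \<Sum>\<nu>\<in>X. c \<nu> * dmonom (Z w) \<nu> i) \<longlongrightarrow> g' w) (finite_subsets_at_top UNIV)"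
  proof (rule has_complex_derivative_uniform_limit[OF _ ul _ e])
    show "\<forall>\<^sub>F X in finite_subsets_at_top UNIV.
        continuous_on (cball (z $ i) e) (\<lambda>w. \<Sum>\<nu>\<in>X. c \<nu> * monom (Z w) \<nu>) \<and>
        (\<forall>w\<in>ball (z $ i) e. ((\<lambda>w. \<Sum>\<nu>\<in>X. c \<nu> * monom (Z w) \<nu>) has_field_derivative
          (\<Sum>\<nu>\<in>X. c \<nu> * dmonom (Z w) \<nu> i)) (at w))"
      by (intro always_eventually allI conjI ballI continuous_at_imp_continuous_on der
          DERIV_isCont[OF der])
  qed auto
  have "z $ i \<in> ball (z $ i) e" using e by simp
  note g'[OF this]
  moreover have "Z (z $ i) = z" by (simp add: Z_def vec_upd_self)
  ultimately have d: "((\<lambda>w. ps_fun c (Z w)) has_field_derivative (g' (z $ i))) (at (z $ i))"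
    and "((\<lambda>\<nu>. c \<nu> * dmonom z \<nu> i) has_sum g' (z $ i)) UNIV"
    by (simp_all add: has_sum_def)
  moreover have "pdiff (ps_fun c) i z = g' (z $ i)"
    using DERIV_imp_deriv[OF d] by (simp add: pdiff_def Z_def)
  ultimately show ?thesis by (simp add: infsumI)
qed

lemma abs_summable_dmonom:
  fixes c :: "('n::finite \<Rightarrow> nat) \<Rightarrow> complex"
  assumes sum: "(\<lambda>\<nu>. norm (c \<nu>) * (real (tdeg \<nu>) * \<rho> ^ (tdeg \<nu> - 1))) summable_on UNIV"
    and z: "\<And>j. norm (z $ j) \<le> \<rho>"
  shows "(\<lambda>\<nu>. norm (c \<nu> * dmonom z \<nu> i)) summable_on T"
proof (rule summable_on_comparison_test[OF summable_on_subset_banach[OF sum]])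
  have \<rho>: "\<rho> \<ge> 0" using z[of i] norm_ge_zero order_trans by blast
  fix \<nu> :: "'n \<Rightarrow> nat"
  have "norm (dmonom z \<nu> i) \<le> real (\<nu> i) * \<rho> ^ (tdeg \<nu> - 1)"
    by (rule norm_dmonom_le[OF z])
  also have "\<dots> \<le> real (tdeg \<nu>) * \<rho> ^ (tdeg \<nu> - 1)"
    using \<rho> by (intro mult_right_mono) (auto simp: le_tdeg)
  finally show "norm (c \<nu> * dmonom z \<nu> i) \<le> norm (c \<nu>) * (real (tdeg \<nu>) * \<rho> ^ (tdeg \<nu> - 1))"
    by (simp add: norm_mult mult_left_mono)
qed auto

text \<open>A derivative of a monomial of degree above \<open>N\<close> has degree at least
  \<open>N\<close>, so \<open>(s / \<rho>) ^ N\<close> can be pulled out of every term and the rest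
  summed at radius \<open>\<rho>\<close>. The degree condition concerns only terms that do not
  vanish at \<open>z\<close>; this covers both the complement of a finite set of exponents and all
  exponents at a point of an axis.\<close>

lemma dmonom_tail_bound:
  fixes c :: "('n::finite \<Rightarrow> nat) \<Rightarrow> complex"
  assumes sum: "(\<lambda>\<nu>. norm (c \<nu>) * (real (tdeg \<nu>) * \<rho> ^ (tdeg \<nu> - 1))) summable_on UNIV"
    and "\<rho> > 0"
  obtains K where "K \<ge> 0"
    "\<And>z s i T. (\<And>j. norm (z $ j) \<le> s) \<Longrightarrow> s \<le> \<rho> \<Longrightarrow>
       (\<And>\<nu>. \<nu> \<in> T \<Longrightarrow> c \<nu> * dmonom z \<nu> i \<noteq> 0 \<Longrightarrow> N < tdeg \<nu>) \<Longrightarrow>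
       norm (\<Sum>\<^sub>\<infinity>\<nu>\<in>T. c \<nu> * dmonom z \<nu> i) \<le> K * s ^ N"
proof
  define M where "M = (\<lambda>\<nu>. norm (c \<nu>) * (real (tdeg \<nu>) * \<rho> ^ (tdeg \<nu> - 1)))"
  have M: "M summable_on T" for T using sum summable_on_subset_banach unfolding M_def by blast
  have M0: "M \<nu> \<ge> 0" for \<nu> using \<open>\<rho> > 0\<close> by (simp add: M_def)
  show "infsum M UNIV / \<rho> ^ N \<ge> 0"
    using \<open>\<rho> > 0\<close> M0 by (simp add: infsum_nonneg)
  fix z :: "complex^'n" and s i T
  assume z: "\<And>j. norm (z $ j) \<le> s" and s: "s \<le> \<rho>"
    and T: "\<And>\<nu>. \<nu> \<in> T \<Longrightarrow> c \<nu> * dmonom z \<nu> i \<noteq> 0 \<Longrightarrow> N < tdeg \<nu>"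
  have s0: "s \<ge> 0" using z[of i] norm_ge_zero order_trans by blast
  have z': "norm (z $ j) \<le> \<rho>" for j using z[of j] s by simp
  have bd: "norm (c \<nu> * dmonom z \<nu> i) \<le> M \<nu> * (s / \<rho>) ^ N" if "\<nu> \<in> T" for \<nu>
  proof (cases "c \<nu> * dmonom z \<nu> i = 0")
    case False
    \<comment> \<open>One degree is lost to differentiation and \<open>N\<close> go into
      \<open>s ^ N\<close>; the remaining \<open>k\<close> are estimated at
      \<open>\<rho>\<close>.\<close>
    define k where "k = tdeg \<nu> - 1 - N"
    have k: "tdeg \<nu> - 1 = N + k" using T[OF that False] by (simp add: k_def)
    have "norm (dmonom z \<nu> i) \<le> real (\<nu> i) * s ^ (tdeg \<nu> - 1)"
      by (rule norm_dmonom_le[OF z])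
    also have "\<dots> \<le> real (tdeg \<nu>) * (s ^ N * \<rho> ^ k)"
      unfolding k power_add using s0 s \<open>\<rho> > 0\<close>
      by (intro mult_mono power_mono) (auto simp: le_tdeg)
    also have "s ^ N * \<rho> ^ k = \<rho> ^ (tdeg \<nu> - 1) * (s / \<rho>) ^ N"
      unfolding k using \<open>\<rho> > 0\<close> by (simp add: power_add power_divide)
    finally have "norm (c \<nu>) * norm (dmonom z \<nu> i)
        \<le> norm (c \<nu>) * (real (tdeg \<nu>) * (\<rho> ^ (tdeg \<nu> - 1) * (s / \<rho>) ^ N))"
      by (rule mult_left_mono) simp
    thus ?thesis by (simp only: M_def norm_mult mult.assoc)
  next
    case True
    moreover have "0 \<le> M \<nu> * (s / \<rho>) ^ N" using M0 s0 \<open>\<rho> > 0\<close> by simp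
    ultimately show ?thesis by (simp only: norm_zero)
  qed
  have "norm (\<Sum>\<^sub>\<infinity>\<nu>\<in>T. c \<nu> * dmonom z \<nu> i) \<le> (\<Sum>\<^sub>\<infinity>\<nu>\<in>T. norm (c \<nu> * dmonom z \<nu> i))"
    by (intro norm_infsum_bound abs_summable_dmonom[OF sum z'])
  also have "\<dots> \<le> (\<Sum>\<^sub>\<infinity>\<nu>\<in>T. M \<nu> * (s / \<rho>) ^ N)"
    by (intro infsum_mono abs_summable_dmonom[OF sum z'] summable_on_cmult_left M bd)
  also have "\<dots> = infsum M T * (s / \<rho>) ^ N"
    by (rule infsum_cmult_left')
  also have "\<dots> \<le> infsum M UNIV * (s / \<rho>) ^ N"
    using s0 \<open>\<rho> > 0\<close> by (intro mult_right_mono infsum_mono2 M) (auto simp: M0)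
  finally show "norm (\<Sum>\<^sub>\<infinity>\<nu>\<in>T. c \<nu> * dmonom z \<nu> i) \<le> infsum M UNIV / \<rho> ^ N * s ^ N"
    by (simp add: power_divide)
qed

subsection \<open>Limits of sequences in the torus\<close>

lemma common_convergent_subsequence:
  fixes f :: "'a \<Rightarrow> nat \<Rightarrow> 'b::heine_borel"
  assumes "finite S" "\<And>x. x \<in> S \<Longrightarrow> bounded (range (f x))"
  shows "\<exists>l r. strict_mono (r :: nat \<Rightarrow> nat) \<and> (\<forall>x\<in>S. (\<lambda>k. f x (r k)) \<longlonglongrightarrow> l x)"
  using assms
proof (induction S rule: finite_induct)
  case empty
  show ?case using strict_mono_id by (auto intro!: exI[of _ id])
next
  case (insert a S)
  then obtain l r where lr: "strict_mono r" "\<And>x. x \<in> S \<Longrightarrow> (\<lambda>k. f x (r k)) \<longlonglongrightarrow> l x" by auto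
  have "bounded (range (f a \<circ> r))"
    using insert.prems[of a] by (auto intro: bounded_subset)
  from bounded_imp_convergent_subsequence[OF this]
  obtain la r' where r': "strict_mono r'" "(f a \<circ> r \<circ> r') \<longlonglongrightarrow> la" by blast
  show ?case
  proof (intro exI conjI ballI)
    show "strict_mono (r \<circ> r')" using lr(1) r'(1) by (rule strict_mono_o)
    fix x assume "x \<in> insert a S"
    thus "(\<lambda>k. f x ((r \<circ> r') k)) \<longlonglongrightarrow> (l(a := la)) x"
      using r' insert.hyps LIMSEQ_subseq_LIMSEQ[OF lr(2) r'(1), of x] by (auto simp: o_def)
  qed
qed

section \<open>Logarithmic coordinates and weights\<close>

lemma inner_nu_vec: "P \<bullet> nu_vec \<nu> = (\<Sum>i\<in>UNIV. P $ i * real (\<nu> i))"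
  by (simp add: inner_vec_def nu_vec_def)

lemma inner_nu_vec_axis_exp: "P \<bullet> nu_vec (axis_exp j k) = P $ j * real k"
  by (simp add: inner_nu_vec axis_exp_def if_distrib cong: if_cong)

text \<open>Consequently, rescaling by a weight leaves ratios of monomials of equal weight
  unchanged.\<close>

lemma monom_scale:
  "monom (\<chi> i. z $ i * of_real (exp (P $ i))) \<nu> = monom z \<nu> * of_real (exp (P \<bullet> nu_vec \<nu>))"
  by (simp add: monom_def inner_nu_vec exp_sum power_mult_distrib prod.distrib exp_of_nat2_mult)

lemma ln_norm_monom:
  assumes "\<And>i. z $ i \<noteq> 0"
  shows "ln (norm (monom z \<nu>)) = (\<chi> i. ln (norm (z $ i))) \<bullet> nu_vec \<nu>"
proof -
  have "norm (monom z \<nu>) = (\<Prod>i\<in>UNIV. norm (z $ i) ^ \<nu> i)"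
    by (simp add: monom_def norm_power flip: prod_norm)
  thus ?thesis
    using assms by (simp add: ln_prod inner_nu_vec ln_realpow mult.commute)
qed

lemma tendsto_monom:
  "(f \<longlongrightarrow> w) F \<Longrightarrow> ((\<lambda>k. monom (f k) \<nu>) \<longlongrightarrow> monom w \<nu>) F"
  unfolding monom_def by (intro tendsto_intros)

text \<open>
  The logarithmic vectors \<open>x\<close> of a sequence in the torus are split into a part \<open>q\<close> in
  the span of the differences of the exponents that survive in the limit, and an orthogonal part
  \<open>p\<close>. The former converges, so that rescaling the sequence by \<open>exp p\<close> keeps it in a compact
  part of the torus; far out in the sequence, \<open>p\<close> is the weight vector.
\<close>
lemma toric_limit:
  fixes z :: "nat \<Rightarrow> complex ^ 'n::finite"
  assumes "finite S" "\<nu>0 \<in> S"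
    and nz: "\<And>k i. z k $ i \<noteq> 0" and lim0: "z \<longlonglongrightarrow> 0"
    and u: "\<And>\<nu>. \<nu> \<in> S \<Longrightarrow> (\<lambda>k. monom (z k) \<nu> / monom (z k) \<nu>0) \<longlonglongrightarrow> l \<nu>"
  obtains P :: "real ^ 'n" and w :: "complex ^ 'n"
  where "\<And>i. P $ i > 0" "\<And>i. w $ i \<noteq> 0"
    "\<And>\<nu>. \<nu> \<in> S \<Longrightarrow> l \<nu> \<noteq> 0 \<Longrightarrow> P \<bullet> nu_vec \<nu> = P \<bullet> nu_vec \<nu>0"
    "\<And>\<nu>. \<nu> \<in> S \<Longrightarrow> l \<nu> = 0 \<Longrightarrow> P \<bullet> nu_vec \<nu> > P \<bullet> nu_vec \<nu>0"
    "\<And>\<nu>. \<nu> \<in> S \<Longrightarrow> l \<nu> \<noteq> 0 \<Longrightarrow> monom w \<nu> = l \<nu> * monom w \<nu>0"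
proof -
  define A where "A = {\<nu>\<in>S. l \<nu> \<noteq> 0}"
  define g where "g \<nu> = nu_vec \<nu> - nu_vec \<nu>0" for \<nu> :: "'n \<Rightarrow> nat"
  define u where "u \<nu> k = monom (z k) \<nu> / monom (z k) \<nu>0" for \<nu> k
  \<comment> \<open>With this sign every coordinate tends to infinity as the sequence approaches the
    origin, and dominant monomials get the smallest weight.\<close>
  define x where "x k = (\<chi> i. - ln (norm (z k $ i)))" for k
  have mnz: "monom (z k) \<nu> \<noteq> 0" for k \<nu> by (rule monom_nonzero[OF nz])
  have ul: "u \<nu> \<longlonglongrightarrow> l \<nu>" if "\<nu> \<in> S" for \<nu> using u[OF that] unfolding u_def .
  have xg: "x k \<bullet> g \<nu> = - ln (norm (u \<nu> k))" for k \<nu>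
  proof -
    have "x k = - (\<chi> i. ln (norm (z k $ i)))" by (simp add: x_def vec_eq_iff)
    hence "x k \<bullet> nu_vec \<nu> = - ln (norm (monom (z k) \<nu>))" for \<nu>
      by (simp add: ln_norm_monom[OF nz])
    thus ?thesis using mnz by (simp add: g_def u_def inner_diff_right norm_divide ln_div)
  qed
  have x_top: "filterlim (\<lambda>k. x k $ i) at_top sequentially" for i
  proof -
    have "(\<lambda>k. norm (z k $ i)) \<longlonglongrightarrow> 0"
      using tendsto_vec_nth[OF lim0, of i] by (simp add: tendsto_norm_zero)
    hence "filterlim (\<lambda>k. norm (z k $ i)) (at_right 0) sequentially"
      using nz by (auto simp: filterlim_at)
    from filterlim_compose[OF ln_at_0 this] show ?thesis
      by (simp add: x_def filterlim_uminus_at_top)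
  qed
  have "\<exists>q p. q \<in> span (g ` A) \<and> (\<forall>v\<in>span (g ` A). orthogonal p v) \<and> x k = q + p" for k
    by (metis orthogonal_subspace_decomp_exists)
  then obtain q p where q: "\<And>k. q k \<in> span (g ` A)"
    and p: "\<And>k v. v \<in> span (g ` A) \<Longrightarrow> p k \<bullet> v = 0" and x: "\<And>k. x k = q k + p k"
    unfolding orthogonal_def by metis
  \<comment> \<open>On a generator \<open>g \<nu>\<close> with \<open>\<nu> \<in> A\<close>, pairing
    with \<open>q\<close> equals pairing with \<open>x\<close>, that is, minus the logarithm of a
    ratio with nonzero limit. Linearity extends this to the span.\<close>
  have conv_span: "convergent (\<lambda>k. q k \<bullet> v)" if "v \<in> span (g ` A)" for v
    using that
  proof (induction rule: span_induct_alt)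
    case base
    show ?case by (simp add: convergent_const)
  next
    case (step a v v')
    then obtain \<nu> where \<nu>: "v = g \<nu>" "\<nu> \<in> A" by blast
    hence "v \<in> span (g ` A)" by (auto intro: span_base)
    hence "q k \<bullet> v = - ln (norm (u \<nu> k))" for k
      using p[of v k] xg[of k \<nu>] by (simp add: x \<nu> inner_add_left)
    moreover have "(\<lambda>k. - ln (norm (u \<nu> k))) \<longlonglongrightarrow> - ln (norm (l \<nu>))"
      using \<nu> ul by (intro tendsto_intros) (auto simp: A_def)
    ultimately have "convergent (\<lambda>k. q k \<bullet> v)" by (simp add: convergent_def) blast
    hence "convergent (\<lambda>k. a * (q k \<bullet> v) + q k \<bullet> v')"
      using step by (intro convergent_add convergent_mult convergent_const)
    thus ?case by (simp add: inner_add_right)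
  qed
  \<comment> \<open>Since \<open>q k\<close> lies in the span, it sees only the projection
    \<open>s\<close> of the axis vector onto the span.\<close>
  have "convergent (\<lambda>k. q k $ i)" for i
  proof -
    obtain s t where st: "s \<in> span (g ` A)" "\<And>v. v \<in> span (g ` A) \<Longrightarrow> orthogonal t v"
      "axis i 1 = s + t" by (metis orthogonal_subspace_decomp_exists)
    have "q k $ i = q k \<bullet> s" for k
    proof -
      have "q k $ i = q k \<bullet> axis i 1" by (simp add: inner_axis)
      also have "\<dots> = q k \<bullet> s"
        using st(2)[OF q[of k]] by (simp add: st(3) inner_add_right orthogonal_def inner_commute)
      finally show ?thesis .
    qed
    thus ?thesis using conv_span[OF st(1)] by simp
  qed
  hence q_lim: "(\<lambda>k. q k $ i) \<longlonglongrightarrow> lim (\<lambda>k. q k $ i)" for i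
    by (simp add: convergent_LIMSEQ_iff)
  define y where "y = (\<chi> i. lim (\<lambda>k. q k $ i))"
  have qy: "q \<longlonglongrightarrow> y"
    by (rule vec_tendstoI) (use q_lim in \<open>simp add: y_def\<close>)

  \<comment> \<open>The factor \<open>exp p\<close> cancels the contribution of \<open>p\<close> to
    the moduli, leaving \<open>exp (- q)\<close>, which has a positive limit.\<close>
  define W where "W k = (\<chi> i. z k $ i * of_real (exp (p k $ i)))" for k
  have normW: "norm (W k $ i) = exp (- q k $ i)" for k i
  proof -
    have "norm (z k $ i) = exp (- x k $ i)" using nz by (simp add: x_def)
    thus ?thesis by (simp add: W_def norm_mult x flip: exp_add)
  qed
  have lim_normW: "(\<lambda>k. norm (W k $ i)) \<longlonglongrightarrow> exp (- y $ i)" for i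
    unfolding normW by (intro tendsto_intros tendsto_vec_nth qy)
  have "(\<lambda>k. \<Sum>i\<in>UNIV. norm (W k $ i)) \<longlonglongrightarrow> (\<Sum>i\<in>UNIV. exp (- y $ i))"
    by (intro tendsto_sum lim_normW)
  hence "Bseq (\<lambda>k. \<Sum>i\<in>UNIV. norm (W k $ i))"
    by (intro convergent_imp_Bseq) (auto simp: convergent_def)
  hence "Bseq W"
    by (rule Bseq_eventually_mono[rotated])
       (auto simp: norm_vec_def L2_set_le_sum sum_nonneg intro!: always_eventually)
  hence "bounded (range W)" by (simp add: Bseq_eq_bounded)
  from bounded_imp_convergent_subsequence[OF this]
  obtain w r where r: "strict_mono (r :: nat \<Rightarrow> nat)" "(\<lambda>k. W (r k)) \<longlonglongrightarrow> w"
    by (auto simp: o_def)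
  have wnz: "w $ i \<noteq> 0" for i
  proof -
    have "(\<lambda>k. norm (W (r k) $ i)) \<longlonglongrightarrow> norm (w $ i)"
      by (intro tendsto_intros tendsto_vec_nth r)
    moreover have "(\<lambda>k. norm (W (r k) $ i)) \<longlonglongrightarrow> exp (- y $ i)"
      using LIMSEQ_subseq_LIMSEQ[OF lim_normW r(1)] by (simp add: o_def)
    ultimately have "norm (w $ i) = exp (- y $ i)" by (rule LIMSEQ_unique)
    thus ?thesis by (metis exp_not_eq_zero norm_zero)
  qed
  \<comment> \<open>\<open>p k\<close> is orthogonal to the differences of surviving exponents, so
    the rescaling preserves their ratios \<open>u \<nu> k\<close>, which then pass to the limit
    point \<open>w\<close>.\<close>
  have pA: "p k \<bullet> nu_vec \<nu> = p k \<bullet> nu_vec \<nu>0" if "\<nu> \<in> A" for k \<nu>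
    using p[of "g \<nu>" k] span_base[of "g \<nu>" "g ` A"] that by (simp add: g_def inner_diff_right)
  have wA: "monom w \<nu> = l \<nu> * monom w \<nu>0" if "\<nu> \<in> A" for \<nu>
  proof -
    have "monom (W k) \<nu> = u \<nu> k * monom (W k) \<nu>0" for k
      unfolding W_def monom_scale pA[OF that] u_def using mnz[of k \<nu>0] by simp
    moreover have "(\<lambda>k. u \<nu> (r k) * monom (W (r k)) \<nu>0) \<longlonglongrightarrow> l \<nu> * monom w \<nu>0"
      using LIMSEQ_subseq_LIMSEQ[OF ul r(1), of \<nu>] that
      by (intro tendsto_mult tendsto_monom r) (simp add: o_def A_def)
    ultimately have "(\<lambda>k. monom (W (r k)) \<nu>) \<longlonglongrightarrow> l \<nu> * monom w \<nu>0" by simp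
    with tendsto_monom[OF r(2)] show ?thesis by (rule LIMSEQ_unique)
  qed

  \<comment> \<open>\<open>p = x - q\<close>, where \<open>x\<close> diverges to infinity in each
    coordinate while \<open>q\<close> converges.\<close>
  have "eventually (\<lambda>k. p k $ i > 0) sequentially" for i
  proof -
    have "filterlim (\<lambda>k. - q k $ i + x k $ i) at_top sequentially"
      by (rule filterlim_tendsto_add_at_top[OF tendsto_minus[OF tendsto_vec_nth[OF qy]] x_top])
    thus ?thesis by (simp add: x filterlim_at_top_dense)
  qed
  hence "eventually (\<lambda>k. \<forall>i\<in>UNIV. p k $ i > 0) sequentially"
    by (intro eventually_ball_finite) auto
  \<comment> \<open>Here the ratio tends to zero, so \<open>x k \<bullet> g \<nu>\<close> tends to
    infinity while the share of \<open>q\<close> converges.\<close>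
  moreover have "eventually (\<lambda>k. p k \<bullet> g \<nu> > 0) sequentially" if "\<nu> \<in> S - A" for \<nu>
  proof -
    have "(\<lambda>k. norm (u \<nu> k)) \<longlonglongrightarrow> 0"
      using ul[of \<nu>] that by (auto simp: A_def intro: tendsto_norm_zero)
    hence "filterlim (\<lambda>k. norm (u \<nu> k)) (at_right 0) sequentially"
      using mnz by (auto simp: filterlim_at u_def)
    from filterlim_compose[OF ln_at_0 this] have "filterlim (\<lambda>k. x k \<bullet> g \<nu>) at_top sequentially"
      by (simp add: xg filterlim_uminus_at_top)
    hence "filterlim (\<lambda>k. - (q k \<bullet> g \<nu>) + x k \<bullet> g \<nu>) at_top sequentially"
      by (rule filterlim_tendsto_add_at_top[OF tendsto_minus[OF tendsto_inner[OF qy tendsto_const]]])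
    thus ?thesis by (simp add: x inner_add_left filterlim_at_top_dense)
  qed
  hence "eventually (\<lambda>k. \<forall>\<nu>\<in>S - A. p k \<bullet> g \<nu> > 0) sequentially"
    using \<open>finite S\<close> by (intro eventually_ball_finite) auto
  ultimately have "eventually (\<lambda>k. (\<forall>i\<in>UNIV. p k $ i > 0) \<and> (\<forall>\<nu>\<in>S - A. p k \<bullet> g \<nu> > 0)) sequentially"
    by (rule eventually_conj)
  \<comment> \<open>Finitely many eventual conditions hold at a common index \<open>k\<close>; the
    weight is \<open>p k\<close>.\<close>
  from eventually_happens'[OF _ this]
  obtain k where k: "\<And>i. p k $ i > 0" "\<And>\<nu>. \<nu> \<in> S - A \<Longrightarrow> p k \<bullet> g \<nu> > 0" by auto
  show thesis
  proof (rule that)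
    show "p k \<bullet> nu_vec \<nu>0 < p k \<bullet> nu_vec \<nu>" if "\<nu> \<in> S" "l \<nu> = 0" for \<nu>
      using k(2)[of \<nu>] that by (simp add: A_def g_def inner_diff_right)
  qed (use k(1) wnz pA wA in \<open>auto simp: A_def\<close>)
qed

subsection \<open>The lower bound from non-degeneracy\<close>

text \<open>For nonnegative \<open>P\<close>, the half-space
  \<open>P \<bullet> x \<ge> P \<bullet> nu_vec \<nu>0\<close> is convex and contains the orthant
  above every exponent of the support, hence the whole diagram. So the index set of
  \<open>face_fun\<close> can be read off from the coefficients.\<close>

lemma face_support:
  fixes c :: "('n::finite \<Rightarrow> nat) \<Rightarrow> complex"
  assumes P: "\<And>i. P $ i \<ge> 0" and "c \<nu>0 \<noteq> 0"
    and min: "\<And>\<nu>. c \<nu> \<noteq> 0 \<Longrightarrow> P \<bullet> nu_vec \<nu>0 \<le> P \<bullet> nu_vec \<nu>"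
  shows "{\<nu>. c \<nu> \<noteq> 0 \<and> nu_vec \<nu> \<in> DeltaPf P c} = {\<nu>. c \<nu> \<noteq> 0 \<and> P \<bullet> nu_vec \<nu> = P \<bullet> nu_vec \<nu>0}"
proof -
  have mem: "nu_vec \<nu> \<in> newton_diagram c" if "c \<nu> \<noteq> 0" for \<nu>
    unfolding newton_diagram_def by (rule hull_inc) (use that in \<open>auto simp: nu_vec_def\<close>)
  have "newton_diagram c \<subseteq> {x. P \<bullet> nu_vec \<nu>0 \<le> P \<bullet> x}"
    unfolding newton_diagram_def
  proof (rule hull_minimal)
    show "convex {x. P \<bullet> nu_vec \<nu>0 \<le> P \<bullet> x}"
      using convex_halfspace_ge[of "P \<bullet> nu_vec \<nu>0" P] by simp
    show "(\<Union>\<nu>\<in>{\<nu>. c \<nu> \<noteq> 0}. {x. \<forall>i. real (\<nu> i) \<le> x $ i}) \<subseteq> {x. P \<bullet> nu_vec \<nu>0 \<le> P \<bullet> x}"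
    proof safe
      fix \<nu> and x :: "real^'n"
      assume "c \<nu> \<noteq> 0" and x: "\<forall>i. real (\<nu> i) \<le> x $ i"
      have "P \<bullet> nu_vec \<nu> \<le> P \<bullet> x"
        unfolding inner_vec_def by (intro sum_mono) (use x P in \<open>auto simp: nu_vec_def intro: mult_left_mono\<close>)
      with min[OF \<open>c \<nu> \<noteq> 0\<close>] show "P \<bullet> nu_vec \<nu>0 \<le> P \<bullet> x" by simp
    qed
  qed
  hence "dPf P c = P \<bullet> nu_vec \<nu>0"
    unfolding dPf_def using mem[OF \<open>c \<nu>0 \<noteq> 0\<close>] by (intro cInf_eq_minimum) auto
  thus ?thesis using mem by (auto simp: DeltaPf_def)
qed

lemma finite_tdeg_le: "finite {\<nu> :: 'n::finite \<Rightarrow> nat. tdeg \<nu> \<le> N}"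
proof (rule finite_subset)
  show "{\<nu> :: 'n \<Rightarrow> nat. tdeg \<nu> \<le> N} \<subseteq> Pi\<^sub>E UNIV (\<lambda>_. {..N})"
    using le_tdeg order_trans by (auto simp: PiE_def) blast
  show "finite (Pi\<^sub>E (UNIV :: 'n set) (\<lambda>_. {..N}))" by (intro finite_PiE) auto
qed

text \<open>Compare along the axis \<open>j\<close> of smallest weight \<open>a\<close>: the minimum
  is at most \<open>a * m j \<le> a * N\<close>, whereas \<open>\<nu>\<close> has weight at least
  \<open>a * tdeg \<nu>\<close>.\<close>

lemma high_degree_above_face:
  assumes P: "\<And>i. P $ i > 0"
    and axis: "\<And>j. P \<bullet> nu_vec \<nu>0 \<le> P \<bullet> nu_vec (axis_exp j (m j))" "\<And>j. m j \<le> N"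
    and "tdeg \<nu> > N"
  shows "P \<bullet> nu_vec \<nu>0 < P \<bullet> nu_vec \<nu>"
proof -
  define a where "a = Min (range (\<lambda>i. P $ i))"
  have a: "a \<le> P $ i" for i unfolding a_def by simp
  have "a \<in> range (\<lambda>i. P $ i)" unfolding a_def by (rule Min_in) auto
  then obtain j where j: "P $ j = a" by auto
  have "P \<bullet> nu_vec \<nu>0 \<le> a * real (m j)"
    using axis(1)[of j] by (simp add: inner_nu_vec_axis_exp j)
  also have "\<dots> \<le> a * real N"
    using axis(2) P[of j] j by (intro mult_left_mono) auto
  also have "\<dots> < a * real (tdeg \<nu>)"
    using assms(4) P[of j] j by simp
  also have "\<dots> = (\<Sum>i\<in>UNIV. a * real (\<nu> i))" by (simp add: tdeg_def sum_distrib_left)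
  also have "\<dots> \<le> P \<bullet> nu_vec \<nu>"
    unfolding inner_nu_vec by (intro sum_mono mult_right_mono a) auto
  finally show ?thesis .
qed

text \<open>Counterexamples with constants tending to zero would, through
  \<open>toric_limit\<close>, produce a critical point of a face function in the torus. Fixing the
  dominant exponent \<open>\<nu>0\<close> keeps all ratios to it bounded by 1.\<close>

lemma euler_sum_bound_at_max:
  fixes c :: "('n::finite \<Rightarrow> nat) \<Rightarrow> complex"
  assumes nd: "non_degenerate c"
    and axis: "\<And>j. c (axis_exp j (m j)) \<noteq> 0" "\<And>j. m j \<le> N"
  defines "S \<equiv> {\<nu>. c \<nu> \<noteq> 0 \<and> tdeg \<nu> \<le> N}"
  assumes "\<nu>0 \<in> S"
  shows "\<exists>\<epsilon>>0. \<forall>z. (\<forall>i. z $ i \<noteq> 0 \<and> norm (z $ i) < \<epsilon>) \<and>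
      (\<forall>\<nu>\<in>S. norm (monom z \<nu>) \<le> norm (monom z \<nu>0)) \<longrightarrow>
      \<epsilon> * norm (monom z \<nu>0) \<le> (\<Sum>i\<in>UNIV. norm (euler_sum c S i z))"
proof (rule ccontr)
  assume "\<not> ?thesis"
  hence neg: "\<exists>z. (\<forall>i. z $ i \<noteq> 0 \<and> norm (z $ i) < \<epsilon>) \<and>
      (\<forall>\<nu>\<in>S. norm (monom z \<nu>) \<le> norm (monom z \<nu>0)) \<and>
      (\<Sum>i\<in>UNIV. norm (euler_sum c S i z)) < \<epsilon> * norm (monom z \<nu>0)" if "\<epsilon> > 0" for \<epsilon>
    using that by (simp add: not_le)
  have "\<exists>z. (\<forall>i. z $ i \<noteq> 0 \<and> norm (z $ i) < inverse (real (Suc k))) \<and>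
      (\<forall>\<nu>\<in>S. norm (monom z \<nu>) \<le> norm (monom z \<nu>0)) \<and>
      (\<Sum>i\<in>UNIV. norm (euler_sum c S i z)) < inverse (real (Suc k)) * norm (monom z \<nu>0)" for k
    by (rule neg) simp
  then obtain z where nz: "\<And>k i. z k $ i \<noteq> 0"
    and small: "\<And>k i. norm (z k $ i) < inverse (real (Suc k))"
    and max: "\<And>k \<nu>. \<nu> \<in> S \<Longrightarrow> norm (monom (z k) \<nu>) \<le> norm (monom (z k) \<nu>0)"
    and less: "\<And>k. (\<Sum>i\<in>UNIV. norm (euler_sum c S i (z k))) < inverse (real (Suc k)) * norm (monom (z k) \<nu>0)"
    by metis
  have mnz: "monom (z k) \<nu> \<noteq> 0" for k \<nu> by (rule monom_nonzero[OF nz])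
  have finS: "finite S" using finite_tdeg_le[of N] by (rule finite_subset[rotated]) (auto simp: S_def)
  define u where "u \<nu> k = monom (z k) \<nu> / monom (z k) \<nu>0" for \<nu> k
  have "bounded (range (u \<nu>))" if "\<nu> \<in> S" for \<nu>
    using max[OF that] mnz by (intro boundedI[of _ 1]) (auto simp: u_def norm_divide)
  from common_convergent_subsequence[of S u, OF finS this]
  obtain l r where r: "strict_mono (r :: nat \<Rightarrow> nat)"
    and l: "\<And>\<nu>. \<nu> \<in> S \<Longrightarrow> (\<lambda>k. u \<nu> (r k)) \<longlonglongrightarrow> l \<nu>" by blast
  have "z \<longlonglongrightarrow> 0"
  proof (rule vec_tendstoI)
    fix i
    show "(\<lambda>k. z k $ i) \<longlonglongrightarrow> 0 $ i"
      unfolding zero_index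
      by (rule Lim_null_comparison[OF always_eventually LIMSEQ_inverse_real_of_nat])
         (use small less_imp_le in blast)
  qed
  from LIMSEQ_subseq_LIMSEQ[OF this r] have "(\<lambda>k. z (r k)) \<longlonglongrightarrow> 0" by (simp add: o_def)
  from toric_limit[of S \<nu>0 "\<lambda>k. z (r k)" l, OF finS \<open>\<nu>0 \<in> S\<close> nz this l[unfolded u_def]]
  obtain P w where P: "\<And>i. P $ i > 0" and w: "\<And>i. w $ i \<noteq> 0"
    and Peq: "\<And>\<nu>. \<nu> \<in> S \<Longrightarrow> l \<nu> \<noteq> 0 \<Longrightarrow> P \<bullet> nu_vec \<nu> = P \<bullet> nu_vec \<nu>0"
    and Pgt: "\<And>\<nu>. \<nu> \<in> S \<Longrightarrow> l \<nu> = 0 \<Longrightarrow> P \<bullet> nu_vec \<nu> > P \<bullet> nu_vec \<nu>0"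
    and wl: "\<And>\<nu>. \<nu> \<in> S \<Longrightarrow> l \<nu> \<noteq> 0 \<Longrightarrow> monom w \<nu> = l \<nu> * monom w \<nu>0"
    by metis
  define A where "A = {\<nu>\<in>S. l \<nu> \<noteq> 0}"
  have PS: "P \<bullet> nu_vec \<nu>0 \<le> P \<bullet> nu_vec \<nu>" if "\<nu> \<in> S" for \<nu>
    using Peq[OF that] Pgt[OF that] by fastforce
  \<comment> \<open>The axis monomials lie in \<open>S\<close>, so minimality on \<open>S\<close>
    controls every exponent of degree above \<open>N\<close>.\<close>
  have PN: "P \<bullet> nu_vec \<nu>0 < P \<bullet> nu_vec \<nu>" if "tdeg \<nu> > N" for \<nu>
    by (rule high_degree_above_face[OF P PS axis(2) that]) (use axis in \<open>simp add: S_def tdeg_axis_exp\<close>)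
  \<comment> \<open>Truncation to \<open>S\<close> leaves the face intact: its exponents are those
    whose ratio survives in the limit.\<close>
  have "{\<nu>. c \<nu> \<noteq> 0 \<and> nu_vec \<nu> \<in> DeltaPf P c} = {\<nu>. c \<nu> \<noteq> 0 \<and> P \<bullet> nu_vec \<nu> = P \<bullet> nu_vec \<nu>0}"
  proof (rule face_support)
    fix \<nu> assume "c \<nu> \<noteq> 0"
    thus "P \<bullet> nu_vec \<nu>0 \<le> P \<bullet> nu_vec \<nu>"
      using PS[of \<nu>] PN[of \<nu>] by (cases "tdeg \<nu> \<le> N") (auto simp: S_def)
  qed (use \<open>\<nu>0 \<in> S\<close> P less_imp_le in \<open>auto simp: S_def\<close>)
  also have "\<dots> = A"
  proof (intro Set.equalityI subsetI)
    fix \<nu> assume "\<nu> \<in> {\<nu>. c \<nu> \<noteq> 0 \<and> P \<bullet> nu_vec \<nu> = P \<bullet> nu_vec \<nu>0}"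
    thus "\<nu> \<in> A" using PN[of \<nu>] Pgt[of \<nu>] by (force simp: A_def S_def not_le)
  qed (use Peq in \<open>auto simp: A_def S_def\<close>)
  finally have face: "face_fun c P = (\<lambda>z. \<Sum>\<nu>\<in>A. c \<nu> * monom z \<nu>)"
    by (simp add: face_fun_def fun_eq_iff)
  have "grad (face_fun c P) w $ i = 0" for i
  proof -
    \<comment> \<open>Divided by the dominant monomial, the Euler sums converge, and the choice of
      the sequence bounds them by a null sequence.\<close>
    have "(\<lambda>k. \<Sum>\<nu>\<in>S. of_nat (\<nu> i) * c \<nu> * u \<nu> (r k)) \<longlonglongrightarrow> (\<Sum>\<nu>\<in>S. of_nat (\<nu> i) * c \<nu> * l \<nu>)"
      by (intro tendsto_intros l)
    moreover have "(\<lambda>k. \<Sum>\<nu>\<in>S. of_nat (\<nu> i) * c \<nu> * u \<nu> (r k)) \<longlonglongrightarrow> 0"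
    proof (rule Lim_null_comparison[OF always_eventually])
      show "\<forall>k. norm (\<Sum>\<nu>\<in>S. of_nat (\<nu> i) * c \<nu> * u \<nu> (r k)) \<le> inverse (real (Suc (r k)))"
      proof
        fix k
        have "(\<Sum>\<nu>\<in>S. of_nat (\<nu> i) * c \<nu> * u \<nu> (r k)) = euler_sum c S i (z (r k)) / monom (z (r k)) \<nu>0"
          by (simp add: euler_sum_def u_def sum_divide_distrib)
        moreover have "norm (euler_sum c S i (z (r k))) \<le> (\<Sum>i\<in>UNIV. norm (euler_sum c S i (z (r k))))"
          by (rule member_le_sum) auto
        ultimately show "norm (\<Sum>\<nu>\<in>S. of_nat (\<nu> i) * c \<nu> * u \<nu> (r k)) \<le> inverse (real (Suc (r k)))"
          using less[of "r k"] mnz[of "r k" \<nu>0] by (simp add: norm_divide pos_divide_le_eq)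
      qed
      show "(\<lambda>k. inverse (real (Suc (r k)))) \<longlonglongrightarrow> 0"
        using LIMSEQ_subseq_LIMSEQ[OF LIMSEQ_inverse_real_of_nat r] by (simp add: o_def)
    qed
    ultimately have "(\<Sum>\<nu>\<in>S. of_nat (\<nu> i) * c \<nu> * l \<nu>) = 0" by (rule LIMSEQ_unique)
    \<comment> \<open>Multiplying by \<open>monom w \<nu>0\<close> turns each surviving
      \<open>l \<nu>\<close> into \<open>monom w \<nu>\<close>, so the sum becomes
      \<open>w $ i\<close> times a partial derivative of the face function.\<close>
    hence "(\<Sum>\<nu>\<in>S. of_nat (\<nu> i) * c \<nu> * l \<nu>) * monom w \<nu>0 = 0" by simp
    also have "(\<Sum>\<nu>\<in>S. of_nat (\<nu> i) * c \<nu> * l \<nu>) = (\<Sum>\<nu>\<in>A. of_nat (\<nu> i) * c \<nu> * l \<nu>)"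
      using finS by (intro sum.mono_neutral_right) (auto simp: A_def)
    also have "\<dots> * monom w \<nu>0 = (\<Sum>\<nu>\<in>A. c \<nu> * (of_nat (\<nu> i) * monom w \<nu>))"
      unfolding sum_distrib_right by (intro sum.cong) (auto simp: A_def wl)
    also have "\<dots> = w $ i * grad (face_fun c P) w $ i"
      using finS by (simp add: face grad_def pdiff_sum_monom A_def sum_distrib_left flip: mult_dmonom)
        (simp add: mult_ac)
    finally show ?thesis using w by simp
  qed
  hence "grad (face_fun c P) w = 0" by (simp add: vec_eq_iff)
  thus False using nd P w unfolding non_degenerate_def by blast
qed

text \<open>\<open>S\<close> is finite, so the least of the constants for the possible dominant
  exponents serves all points of the torus, and a bound on the dominant monomial bounds the others.
  Both sides are continuous, which extends the estimate to points with zero coordinates.\<close>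

lemma euler_sum_bound:
  fixes c :: "('n::finite \<Rightarrow> nat) \<Rightarrow> complex"
  assumes nd: "non_degenerate c"
    and axis: "\<And>j. c (axis_exp j (m j)) \<noteq> 0" "\<And>j. m j \<le> N"
  defines "S \<equiv> {\<nu>. c \<nu> \<noteq> 0 \<and> tdeg \<nu> \<le> N}"
  obtains \<epsilon> where "\<epsilon> > 0" "\<And>z \<nu>. (\<And>i. norm (z $ i) < \<epsilon>) \<Longrightarrow> \<nu> \<in> S \<Longrightarrow>
      \<epsilon> * norm (monom z \<nu>) \<le> (\<Sum>i\<in>UNIV. norm (euler_sum c S i z))"
proof -
  have finS: "finite S" using finite_tdeg_le[of N] by (rule finite_subset[rotated]) (auto simp: S_def)
  have S0: "S \<noteq> {}" using axis by (auto simp: S_def tdeg_axis_exp intro!: exI[of _ "axis_exp _ (m _)"])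
  from euler_sum_bound_at_max[OF nd axis, folded S_def]
  obtain e where e: "\<And>\<nu>0. \<nu>0 \<in> S \<Longrightarrow> e \<nu>0 > 0"
    "\<And>\<nu>0 z. \<nu>0 \<in> S \<Longrightarrow> (\<And>i. z $ i \<noteq> 0 \<and> norm (z $ i) < e \<nu>0) \<Longrightarrow>
      (\<And>\<nu>. \<nu> \<in> S \<Longrightarrow> norm (monom z \<nu>) \<le> norm (monom z \<nu>0)) \<Longrightarrow>
      e \<nu>0 * norm (monom z \<nu>0) \<le> (\<Sum>i\<in>UNIV. norm (euler_sum c S i z))"
    by metis
  define \<epsilon> where "\<epsilon> = Min (e ` S)"
  have \<epsilon>: "\<epsilon> > 0" using finS S0 e by (simp add: \<epsilon>_def)
  have \<epsilon>_le: "\<epsilon> \<le> e \<nu>" if "\<nu> \<in> S" for \<nu> using finS that by (simp add: \<epsilon>_def)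
  have torus: "\<epsilon> * norm (monom z \<nu>) \<le> (\<Sum>i\<in>UNIV. norm (euler_sum c S i z))"
    if z: "\<And>i. z $ i \<noteq> 0" "\<And>i. norm (z $ i) < \<epsilon>" and "\<nu> \<in> S" for z \<nu>
  proof -
    have "Max ((\<lambda>\<nu>. norm (monom z \<nu>)) ` S) \<in> (\<lambda>\<nu>. norm (monom z \<nu>)) ` S"
      using finS S0 by (intro Max_in) auto
    then obtain \<nu>0 where "\<nu>0 \<in> S" "norm (monom z \<nu>0) = Max ((\<lambda>\<nu>. norm (monom z \<nu>)) ` S)" by auto
    hence max: "norm (monom z \<nu>) \<le> norm (monom z \<nu>0)" if "\<nu> \<in> S" for \<nu> using finS that by simp
    have "\<epsilon> * norm (monom z \<nu>) \<le> e \<nu>0 * norm (monom z \<nu>0)"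
      using \<epsilon> \<epsilon>_le[OF \<open>\<nu>0 \<in> S\<close>] max[OF \<open>\<nu> \<in> S\<close>] by (intro mult_mono) auto
    also have "\<dots> \<le> (\<Sum>i\<in>UNIV. norm (euler_sum c S i z))"
      by (rule e(2)[OF \<open>\<nu>0 \<in> S\<close> _ max]) (use z \<epsilon>_le[OF \<open>\<nu>0 \<in> S\<close>] less_le_trans in blast)+
    finally show ?thesis .
  qed
  show thesis
  proof (rule that[OF \<epsilon>])
    fix z :: "complex^'n" and \<nu> assume z: "\<And>i. norm (z $ i) < \<epsilon>" and "\<nu> \<in> S"
    \<comment> \<open>points off the torus are handled by density\<close>
    define y where "y k = (\<chi> i. if z $ i = 0 then of_real (\<epsilon> * inverse (real (Suc (Suc k)))) else z $ i)" for k
    have "(\<lambda>k. \<epsilon> * inverse (real (Suc (Suc k)))) \<longlonglongrightarrow> \<epsilon> * 0"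
      by (intro tendsto_intros LIMSEQ_Suc[OF LIMSEQ_inverse_real_of_nat])
    from tendsto_of_real[OF this]
    have inv0: "(\<lambda>k. of_real (\<epsilon> * inverse (real (Suc (Suc k)))) :: complex) \<longlonglongrightarrow> 0" by (simp only: mult_zero_right of_real_0)
    have y: "y \<longlonglongrightarrow> z"
    proof (rule vec_tendstoI)
      show "(\<lambda>k. y k $ i) \<longlonglongrightarrow> z $ i" for i
        using inv0 by (cases "z $ i = 0") (simp_all only: y_def vec_lambda_beta if_True if_False simp_thms tendsto_const)
    qed
    \<comment> \<open>The double \<open>Suc\<close> matters: a single one would give the factor 1 at
      \<open>k = 0\<close>, but the replaced coordinates must stay strictly below
      \<open>\<epsilon>\<close>.\<close>
    have "inverse (real (Suc (Suc k))) < 1" for k by (simp add: field_simps)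
    hence less: "\<epsilon> * inverse (real (Suc (Suc k))) < \<epsilon>" for k
      using mult_strict_left_mono[OF _ \<epsilon>, of _ 1] by simp
    have "\<epsilon> * norm (monom (y k) \<nu>) \<le> (\<Sum>i\<in>UNIV. norm (euler_sum c S i (y k)))" for k
    proof (rule torus)
      fix i
      show "y k $ i \<noteq> 0" using \<epsilon> by (simp add: y_def del: of_nat_Suc)
      show "norm (y k $ i) < \<epsilon>" using \<epsilon> z[of i] less[of k]
        by (simp add: y_def norm_mult norm_inverse del: of_nat_Suc)
    qed fact
    moreover have "(\<lambda>k. \<epsilon> * norm (monom (y k) \<nu>)) \<longlonglongrightarrow> \<epsilon> * norm (monom z \<nu>)"
      by (intro tendsto_intros tendsto_monom y)
    moreover have "(\<lambda>k. \<Sum>i\<in>UNIV. norm (euler_sum c S i (y k))) \<longlonglongrightarrow> (\<Sum>i\<in>UNIV. norm (euler_sum c S i z))"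
      unfolding euler_sum_def by (intro tendsto_intros tendsto_monom y)
    ultimately show "\<epsilon> * norm (monom z \<nu>) \<le> (\<Sum>i\<in>UNIV. norm (euler_sum c S i z))"
      by (intro LIMSEQ_le[where X="\<lambda>k. \<epsilon> * norm (monom (y k) \<nu>)"]) auto
  qed
qed

subsection \<open>Newton boundary and gradient bounds\<close>

text \<open>If a combination with two positive weights lands on the axis, nonnegativity forces both
  endpoints onto the axis, where the claim is one-dimensional.\<close>

lemma convex_off_axis_segment:
  "convex {x :: real^'n::finite. (\<forall>i. x $ i \<ge> 0) \<and> ((\<forall>i. i \<noteq> j \<longrightarrow> x $ i = 0) \<longrightarrow> x $ j > t)}"
  (is "convex ?K")
proof (rule convexI)
  fix x y :: "real^'n" and u v :: real
  assume xy: "x \<in> ?K" "y \<in> ?K" and uv: "0 \<le> u" "0 \<le> v" "u + v = 1"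
  have "(u *\<^sub>R x + v *\<^sub>R y) $ j > t" if off: "\<And>i. i \<noteq> j \<Longrightarrow> (u *\<^sub>R x + v *\<^sub>R y) $ i = 0"
  proof -
    have ux: "u = 0 \<or> x $ i = 0" "v = 0 \<or> y $ i = 0" if "i \<noteq> j" for i
    proof -
      have "u * x $ i \<ge> 0" "v * y $ i \<ge> 0" using xy uv by simp_all
      moreover have "u * x $ i + v * y $ i = 0" using off[OF that] by simp
      ultimately show "u = 0 \<or> x $ i = 0" "v = 0 \<or> y $ i = 0"
        by (simp_all add: add_nonneg_eq_0_iff)
    qed
    consider "u = 0" "v = 1" | "v = 0" "u = 1" | "u > 0" "v > 0" using uv by fastforce
    thus ?thesis
    proof cases
      case 3
      hence "x $ j > t" "y $ j > t" using ux xy by auto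
      hence "u * x $ j + v * y $ j > u * t + v * t"
        using 3 by (intro add_strict_mono mult_strict_left_mono)
      also have "u * t + v * t = t" using uv by (simp flip: distrib_right)
      finally show ?thesis by simp
    qed (use ux xy in auto)
  qed
  thus "u *\<^sub>R x + v *\<^sub>R y \<in> ?K" using xy uv by simp
qed

text \<open>An orthant meeting the axis must start at an exponent on the axis. If all such exponents
  exceeded \<open>t\<close>, every orthant, and so the hull, would lie in the convex set
  \<open>?K\<close>, which omits the given point.\<close>

lemma newton_diagram_axis:
  fixes c :: "('n::finite \<Rightarrow> nat) \<Rightarrow> complex"
  assumes "t *\<^sub>R axis j 1 \<in> newton_diagram c"
  obtains k where "c (axis_exp j k) \<noteq> 0" "real k \<le> t"
proof (rule ccontr)
  assume "\<not> thesis"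
  hence gt: "\<And>k. c (axis_exp j k) \<noteq> 0 \<Longrightarrow> real k > t" using that by (meson not_le)
  let ?K = "{x :: real^'n. (\<forall>i. x $ i \<ge> 0) \<and> ((\<forall>i. i \<noteq> j \<longrightarrow> x $ i = 0) \<longrightarrow> x $ j > t)}"
  have "newton_diagram c \<subseteq> ?K"
    unfolding newton_diagram_def
  proof (rule hull_minimal)
    show "(\<Union>\<nu>\<in>{\<nu>. c \<nu> \<noteq> 0}. {x. \<forall>i. real (\<nu> i) \<le> x $ i}) \<subseteq> ?K"
    proof safe
      fix \<nu> and x :: "real^'n"
      assume c: "c \<nu> \<noteq> 0" and x: "\<forall>i. real (\<nu> i) \<le> x $ i"
      show "x $ i \<ge> 0" for i using x of_nat_0_le_iff order_trans by blast
      assume off: "\<forall>i. i \<noteq> j \<longrightarrow> x $ i = 0"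
      have "\<nu> i = 0" if "i \<noteq> j" for i using x[rule_format, of i] off that by simp
      hence "\<nu> = axis_exp j (\<nu> j)" by (auto simp: axis_exp_def fun_eq_iff)
      hence "real (\<nu> j) > t" using gt[of "\<nu> j"] c by simp
      thus "t < x $ j" using x less_le_trans by blast
    qed
  qed (rule convex_off_axis_segment)
  with assms have "t *\<^sub>R axis j 1 \<in> ?K" by blast
  thus False by (auto simp: axis_def)
qed

text \<open>
  A face through a non-minimal point of the axis contains a whole ray of the axis, because
  that point lies inside arbitrarily long segments of the diagram.
\<close>
lemma newton_boundary_axis:
  fixes c :: "('n::finite \<Rightarrow> nat) \<Rightarrow> complex"
  assumes c0: "c (\<lambda>_. 0) = 0" and bd: "t *\<^sub>R axis j 1 \<in> newton_boundary c"
  obtains m where "t = real m" "m > 0" "c (axis_exp j m) \<noteq> 0"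
    "\<And>k. k < m \<Longrightarrow> c (axis_exp j k) = 0"
proof -
  obtain F where F: "F face_of newton_diagram c" "compact F" "t *\<^sub>R axis j 1 \<in> F"
    using bd by (auto simp: newton_boundary_def)
  have tN: "t *\<^sub>R axis j 1 \<in> newton_diagram c" using F face_of_imp_subset by blast
  have ge: "t \<le> real k" if k: "c (axis_exp j k) \<noteq> 0" for k
  proof (rule ccontr)
    assume "\<not> t \<le> real k"
    hence kt: "real k < t" by simp
    have inN: "s *\<^sub>R axis j 1 \<in> newton_diagram c" if "s \<ge> real k" for s
      unfolding newton_diagram_def
      by (rule hull_inc) (use k that in \<open>auto simp: axis_exp_def axis_def intro!: exI[of _ "axis_exp j k"]\<close>)
    have inF: "s *\<^sub>R axis j 1 \<in> F" if "s > t" for s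
    proof -
      have "t *\<^sub>R axis j (1::real) \<in> open_segment (real k *\<^sub>R axis j 1) (s *\<^sub>R axis j 1)"
        unfolding in_segment
      proof (intro conjI exI[of _ "(t - real k) / (s - real k)"])
        define u where "u = (t - real k) / (s - real k)"
        have "u * (s - real k) = t - real k" using kt that by (simp add: u_def)
        hence "(1 - u) * real k + u * s = t" by (simp add: algebra_simps)
        thus "t *\<^sub>R axis j (1::real) = (1 - (t - real k) / (s - real k)) *\<^sub>R (real k *\<^sub>R axis j 1) +
           ((t - real k) / (s - real k)) *\<^sub>R (s *\<^sub>R axis j 1)"
          unfolding u_def[symmetric] by (simp flip: scaleR_left.add)
      qed (use kt that in \<open>auto simp: field_simps axis_eq_0_iff\<close>)
      thus ?thesis using face_ofD[OF F(1) _ inN[of "real k"] inN[of s] F(3)] kt that by simp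
    qed
    obtain b where b: "\<And>x. x \<in> F \<Longrightarrow> norm x \<le> b"
      using compact_imp_bounded[OF F(2)] by (auto simp: bounded_iff)
    \<comment> \<open>The parameter exceeds \<open>t\<close>, so the point lies on the ray inside
      \<open>F\<close>; it also exceeds the norm bound \<open>b\<close>.\<close>
    have "norm ((\<bar>t\<bar> + \<bar>b\<bar> + 1) *\<^sub>R axis j (1::real)) \<le> b" by (rule b[OF inF]) simp
    thus False by simp
  qed
  obtain m where m: "c (axis_exp j m) \<noteq> 0" "real m \<le> t" using newton_diagram_axis[OF tN] .
  have t: "t = real m" using ge[OF m(1)] m(2) by simp
  have "axis_exp j 0 = (\<lambda>_. 0)" by (auto simp: axis_exp_def)
  hence "m > 0" using m(1) c0 by (cases m) auto
  moreover have "c (axis_exp j k) = 0" if "k < m" for k using ge[of k] t that by auto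
  ultimately show thesis using that t m(1) by blast
qed

lemma norm_le_card_max:
  fixes z :: "complex^'n::finite"
  obtains j where "\<And>i. norm (z $ i) \<le> norm (z $ j)" "norm z \<le> real CARD('n) * norm (z $ j)"
proof -
  have "Max (range (\<lambda>i. norm (z $ i))) \<in> range (\<lambda>i. norm (z $ i))" by (rule Max_in) auto
  then obtain j where j: "Max (range (\<lambda>i. norm (z $ i))) = norm (z $ j)" by (rule imageE)
  have le: "norm (z $ i) \<le> norm (z $ j)" for i unfolding j [symmetric] by (rule Max_ge) auto
  have "norm z \<le> (\<Sum>i\<in>UNIV. norm (z $ i))" by (simp add: norm_vec_def L2_set_le_sum)
  also have "\<dots> \<le> (\<Sum>i\<in>(UNIV::'n set). norm (z $ j))" by (intro sum_mono le)
  finally show thesis using that[OF le] by simp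
qed

section \<open>Gradient estimates near the origin\<close>

text \<open>Let \<open>s\<close> be the largest modulus of a coordinate. Each Euler sum is
  \<open>z $ i\<close> times the partial derivative without its tail, hence at most
  \<open>s * (G + K * s ^ N)\<close>. Comparison with an axis monomial bounds the sum of these from
  below by \<open>\<epsilon> * s ^ N\<close>; the tail is absorbed for small \<open>s\<close>, and
  dividing by \<open>s\<close> gives the exponent \<open>N - 1\<close>.\<close>

lemma grad_lower_bound:
  fixes c :: "('n::finite \<Rightarrow> nat) \<Rightarrow> complex"
  assumes conv: "convergent_ps c" and nd: "non_degenerate c"
    and axis: "\<And>j. c (axis_exp j (m j)) \<noteq> 0" "\<And>j. m j \<le> N" and "N > 0"
  obtains C where "C > 0"
    "eventually (\<lambda>z. C * norm z ^ (N - 1) \<le> norm (grad (ps_fun c) z)) (at 0)"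
proof -
  obtain \<rho> where \<rho>: "\<rho> > 0" "(\<lambda>\<nu>. norm (c \<nu>) * \<rho> ^ tdeg \<nu>) summable_on UNIV"
    "(\<lambda>\<nu>. norm (c \<nu>) * (real (tdeg \<nu>) * \<rho> ^ (tdeg \<nu> - 1))) summable_on UNIV"
    using convergent_ps_radius[OF conv] .
  define S where "S = {\<nu>. c \<nu> \<noteq> 0 \<and> tdeg \<nu> \<le> N}"
  have finS: "finite S" using finite_tdeg_le[of N] by (rule finite_subset[rotated]) (auto simp: S_def)
  obtain \<epsilon> where \<epsilon>: "\<epsilon> > 0" "\<And>z \<nu>. (\<And>i. norm (z $ i) < \<epsilon>) \<Longrightarrow> \<nu> \<in> S \<Longrightarrow>
      \<epsilon> * norm (monom z \<nu>) \<le> (\<Sum>i\<in>UNIV. norm (euler_sum c S i z))"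
    using euler_sum_bound[OF nd axis, folded S_def] by blast
  obtain K where K: "K \<ge> 0"
    "\<And>z s i T. (\<And>j. norm (z $ j) \<le> s) \<Longrightarrow> s \<le> \<rho> \<Longrightarrow>
       (\<And>\<nu>. \<nu> \<in> T \<Longrightarrow> c \<nu> * dmonom z \<nu> i \<noteq> 0 \<Longrightarrow> N < tdeg \<nu>) \<Longrightarrow>
       norm (\<Sum>\<^sub>\<infinity>\<nu>\<in>T. c \<nu> * dmonom z \<nu> i) \<le> K * s ^ N"
    using dmonom_tail_bound[OF \<rho>(3,1), where N = N] by blast
  define n where "n = real CARD('n)"
  have n: "n > 0" by (simp add: n_def)
  \<comment> \<open>The entries \<open>\<epsilon>\<close> and \<open>\<rho>\<close> give access to
    the two estimates, 1 makes powers of \<open>s\<close> decreasing, and the last one makes the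
    tail at most half of the main term.\<close>
  define \<delta> where "\<delta> = Min {\<epsilon>, \<rho>, 1, \<epsilon> / (2 * n * (K + 1))}"
  have \<delta>: "\<delta> > 0" using \<epsilon> \<rho> K n by (simp add: \<delta>_def)
  have \<delta>_le: "\<delta> \<le> \<epsilon>" "\<delta> \<le> \<rho>" "\<delta> \<le> 1" "\<delta> \<le> \<epsilon> / (2 * n * (K + 1))" by (simp_all add: \<delta>_def)
  have main: "\<epsilon> / (2 * n ^ N) * norm z ^ (N - 1) \<le> norm (grad (ps_fun c) z)"
    if "z \<noteq> 0" "norm z < \<delta>" for z
  proof -
    define G where "G = norm (grad (ps_fun c) z)"
    have zi: "norm (z $ i) < \<delta>" for i
      using Finite_Cartesian_Product.norm_nth_le[of z i] that by simp
    obtain j where j: "\<And>i. norm (z $ i) \<le> norm (z $ j)" "norm z \<le> n * norm (z $ j)"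
      unfolding n_def using norm_le_card_max by blast
    define s where "s = norm (z $ j)"
    have s: "s > 0" "s < \<delta>"
    proof -
      show "s < \<delta>" unfolding s_def by (rule zi)
      have "0 < norm z" using \<open>z \<noteq> 0\<close> by simp
      also have "\<dots> \<le> n * s" unfolding s_def by (rule j(2))
      finally have "n * s > 0" .
      thus "s > 0" using n by (simp add: zero_less_mult_iff)
    qed
    have z\<rho>: "norm (z $ i) < \<rho>" for i using zi[of i] \<delta>_le by simp
    have euler: "norm (euler_sum c S i z) \<le> s * (G + K * s ^ N)" for i
    proof -
      have abs: "(\<lambda>\<nu>. c \<nu> * dmonom z \<nu> i) summable_on T" for T
        by (rule abs_summable_summable, rule abs_summable_dmonom[OF \<rho>(3) less_imp_le[OF z\<rho>]])
      have "grad (ps_fun c) z $ i = (\<Sum>\<^sub>\<infinity>\<nu>\<in>S \<union> - S. c \<nu> * dmonom z \<nu> i)"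
        by (simp add: grad_def pdiff_ps_fun[OF \<rho>(2) z\<rho>])
      also have "\<dots> = (\<Sum>\<nu>\<in>S. c \<nu> * dmonom z \<nu> i) + (\<Sum>\<^sub>\<infinity>\<nu>\<in>- S. c \<nu> * dmonom z \<nu> i)"
        using finS by (subst infsum_Un_disjoint) (auto intro: abs)
      finally have split: "(\<Sum>\<nu>\<in>S. c \<nu> * dmonom z \<nu> i)
          = grad (ps_fun c) z $ i - (\<Sum>\<^sub>\<infinity>\<nu>\<in>- S. c \<nu> * dmonom z \<nu> i)" by simp
      have "euler_sum c S i z = (\<Sum>\<nu>\<in>S. c \<nu> * (of_nat (\<nu> i) * monom z \<nu>))"
        unfolding euler_sum_def by (intro sum.cong) (auto simp: mult_ac)
      also have "\<dots> = z $ i * (\<Sum>\<nu>\<in>S. c \<nu> * dmonom z \<nu> i)"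
        unfolding mult_dmonom[symmetric] sum_distrib_left by (intro sum.cong) (auto simp: mult_ac)
      finally have "norm (euler_sum c S i z)
          = norm (z $ i) * norm (grad (ps_fun c) z $ i - (\<Sum>\<^sub>\<infinity>\<nu>\<in>- S. c \<nu> * dmonom z \<nu> i))"
        unfolding split by (simp only: norm_mult)
      also have "\<dots> \<le> s * (norm (grad (ps_fun c) z $ i) + norm (\<Sum>\<^sub>\<infinity>\<nu>\<in>- S. c \<nu> * dmonom z \<nu> i))"
        using s j(1) by (intro mult_mono norm_triangle_ineq4) (auto simp: s_def)
      also have "\<dots> \<le> s * (G + K * s ^ N)"
      proof (intro mult_left_mono add_mono)
        show "norm (grad (ps_fun c) z $ i) \<le> G"
          unfolding G_def by (rule Finite_Cartesian_Product.norm_nth_le)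
        show "norm (\<Sum>\<^sub>\<infinity>\<nu>\<in>- S. c \<nu> * dmonom z \<nu> i) \<le> K * s ^ N"
        proof (rule K(2))
          show "norm (z $ l) \<le> s" for l unfolding s_def by (rule j(1))
          show "s \<le> \<rho>" using s \<delta>_le by simp
          show "N < tdeg \<nu>" if "\<nu> \<in> - S" "c \<nu> * dmonom z \<nu> i \<noteq> 0" for \<nu>
            using that by (auto simp: S_def)
        qed
      qed (use s in simp)
      finally show ?thesis .
    qed
    have z\<epsilon>: "norm (z $ i) < \<epsilon>" for i using zi[of i] \<delta>_le by simp
    \<comment> \<open>The largest coordinate supplies the estimate: its axis exponent belongs to
      \<open>S\<close>, and \<open>s < 1\<close> allows passing from \<open>m j\<close> to
      \<open>N\<close>.\<close>
    have "\<epsilon> * s ^ N \<le> \<epsilon> * s ^ m j"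
      using s \<delta>_le axis(2)[of j] \<epsilon> by (intro mult_left_mono power_decreasing) auto
    also have "\<dots> = \<epsilon> * norm (monom z (axis_exp j (m j)))"
      by (simp add: monom_axis_exp norm_power s_def)
    also have "\<dots> \<le> (\<Sum>i\<in>UNIV. norm (euler_sum c S i z))"
      by (rule \<epsilon>(2)[OF z\<epsilon>]) (simp add: S_def tdeg_axis_exp axis)
    also have "\<dots> \<le> (\<Sum>i\<in>(UNIV::'n set). s * (G + K * s ^ N))" by (intro sum_mono euler)
    also have "\<dots> = n * s * G + (n * K * s) * s ^ N" by (simp add: n_def algebra_simps)
    finally have *: "\<epsilon> * s ^ N \<le> n * s * G + (n * K * s) * s ^ N" .
    have "s \<le> \<epsilon> / (2 * n * (K + 1))" using s \<delta>_le by simp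
    hence "s * (2 * n * (K + 1)) \<le> \<epsilon>" using n K by (simp add: pos_le_divide_eq)
    moreover have "0 \<le> n * s" using n s by simp
    ultimately have "n * K * s \<le> \<epsilon> / 2" by (simp add: algebra_simps)
    hence "(n * K * s) * s ^ N \<le> \<epsilon> / 2 * s ^ N" using s by (intro mult_right_mono) auto
    with * have "\<epsilon> * s ^ N \<le> n * s * G + \<epsilon> / 2 * s ^ N" by linarith
    hence "\<epsilon> / 2 * s ^ N \<le> n * s * G" by simp
    moreover have "s ^ N = s * s ^ (N - 1)" using \<open>N > 0\<close> by (cases N) auto
    ultimately have "s * (\<epsilon> / 2 * s ^ (N - 1)) \<le> s * (n * G)" by (simp add: mult_ac)
    hence sG: "\<epsilon> / 2 * s ^ (N - 1) \<le> n * G" using s by (simp only: mult_le_cancel_left_pos)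
    \<comment> \<open>Of the \<open>N\<close> factors \<open>n\<close>, \<open>N - 1\<close> come
      from \<open>norm z \<le> n * s\<close> and one from summing over the Euler
      derivatives.\<close>
    have nN: "n ^ N = n * n ^ (N - 1)" using \<open>N > 0\<close> by (cases N) auto
    have "norm z ^ (N - 1) \<le> (n * s) ^ (N - 1)" using j(2) by (intro power_mono) (auto simp: s_def)
    hence "\<epsilon> / (2 * n ^ N) * norm z ^ (N - 1) \<le> \<epsilon> / (2 * n ^ N) * (n * s) ^ (N - 1)"
      using \<epsilon> n by (intro mult_left_mono) auto
    also have "\<dots> = (\<epsilon> / 2 * s ^ (N - 1)) / n" using n by (simp add: nN power_mult_distrib)
    also have "\<dots> \<le> G" using sG n by (simp add: pos_divide_le_eq mult.commute)
    finally show ?thesis unfolding G_def .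
  qed
  show thesis
  proof
    show "\<epsilon> / (2 * n ^ N) > 0" using \<epsilon> n by simp
    show "eventually (\<lambda>z. \<epsilon> / (2 * n ^ N) * norm z ^ (N - 1) \<le> norm (grad (ps_fun c) z)) (at 0)"
      unfolding eventually_at using \<delta> main by (auto intro!: exI[of _ \<delta>])
  qed
qed

text \<open>On the axis only pure powers of \<open>z_i\<close>, or such powers times a single
  \<open>z_j\<close>, contribute to the gradient. The hypotheses remove those of degree below
  \<open>N\<close>, so every partial derivative has order at least \<open>N - 1\<close>.\<close>

lemma grad_upper_bound_on_axis:
  fixes c :: "('n::finite \<Rightarrow> nat) \<Rightarrow> complex"
  assumes conv: "convergent_ps c"
    and axis: "\<And>k. k < N \<Longrightarrow> c (axis_exp i k) = 0"
    and near: "\<And>j k. j \<noteq> i \<Longrightarrow> Suc k < N \<Longrightarrow> c (\<lambda>l. if l = j then 1 else if l = i then k else 0) = 0"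
    and "N > 0"
  obtains K where "eventually
    (\<lambda>t. norm (grad (ps_fun c) (axis i (of_real t))) \<le> K * t ^ (N - 1)) (at_right 0)"
proof -
  obtain \<rho> where \<rho>: "\<rho> > 0" "(\<lambda>\<nu>. norm (c \<nu>) * \<rho> ^ tdeg \<nu>) summable_on UNIV"
    "(\<lambda>\<nu>. norm (c \<nu>) * (real (tdeg \<nu>) * \<rho> ^ (tdeg \<nu> - 1))) summable_on UNIV"
    using convergent_ps_radius[OF conv] .
  \<comment> \<open>The tail bound is taken at \<open>N - 1\<close> because the surviving terms have
    degree at least \<open>N\<close>, and \<open>N > 0\<close>.\<close>
  obtain K where K: "K \<ge> 0"
    "\<And>z s i T. (\<And>j. norm (z $ j) \<le> s) \<Longrightarrow> s \<le> \<rho> \<Longrightarrow>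
       (\<And>\<nu>. \<nu> \<in> T \<Longrightarrow> c \<nu> * dmonom z \<nu> i \<noteq> 0 \<Longrightarrow> N - 1 < tdeg \<nu>) \<Longrightarrow>
       norm (\<Sum>\<^sub>\<infinity>\<nu>\<in>T. c \<nu> * dmonom z \<nu> i) \<le> K * s ^ (N - 1)"
    using dmonom_tail_bound[OF \<rho>(3,1), where N = "N - 1"] by blast
  have main: "norm (grad (ps_fun c) (axis i (of_real t))) \<le> real CARD('n) * K * t ^ (N - 1)"
    if t: "0 < t" "t < \<rho>" for t
  proof -
    define z :: "complex^'n" where "z = axis i (of_real t)"
    have z: "z $ l = (if l = i then of_real t else 0)" for l by (simp add: z_def axis_def)
    have deg: "N \<le> tdeg \<nu>" if nz: "c \<nu> * dmonom z \<nu> j \<noteq> 0" for \<nu> j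
    proof -
      from nz have c: "c \<nu> \<noteq> 0" and "\<nu> j \<noteq> 0" and zj: "z $ j ^ (\<nu> j - 1) \<noteq> 0"
        and off: "\<And>l. l \<noteq> j \<Longrightarrow> z $ l ^ \<nu> l \<noteq> 0"
        by (auto simp: dmonom_def)
      have off0: "\<nu> l = 0" if "l \<noteq> j" "l \<noteq> i" for l
        using off[OF that(1)] that(2) by (auto simp: z power_0_left split: if_splits)
      show ?thesis
      proof (cases "j = i")
        case True
        hence "\<nu> = axis_exp i (\<nu> i)" using off0 by (auto simp: axis_exp_def fun_eq_iff)
        hence "\<not> \<nu> i < N" using axis[of "\<nu> i"] c by auto
        thus ?thesis using le_tdeg[of \<nu> i] by simp
      next
        case False
        \<comment> \<open>Since \<open>z $ j = 0\<close> off the axis direction, the power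
          \<open>z $ j ^ (\<nu> j - 1)\<close> is nonzero only as \<open>0 ^ 0\<close>.\<close>
        hence "\<nu> j = 1" using zj \<open>\<nu> j \<noteq> 0\<close> by (auto simp: z power_0_left split: if_splits)
        hence "\<nu> = (\<lambda>l. if l = j then 1 else if l = i then \<nu> i else 0)"
          using off0 by (auto simp: fun_eq_iff)
        hence "\<not> Suc (\<nu> i) < N" using near[OF False, of "\<nu> i"] c by metis
        moreover have "\<nu> i \<le> (\<Sum>l\<in>UNIV - {j}. \<nu> l)"
          using False by (intro member_le_sum) auto
        ultimately show ?thesis using \<open>\<nu> j = 1\<close> by (simp add: tdeg_split[of \<nu> j])
      qed
    qed
    have comp: "norm (grad (ps_fun c) z $ j) \<le> K * t ^ (N - 1)" for j
    proof -
      have "grad (ps_fun c) z $ j = (\<Sum>\<^sub>\<infinity>\<nu>. c \<nu> * dmonom z \<nu> j)"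
        unfolding grad_def using pdiff_ps_fun[OF \<rho>(2), of z j] t \<rho> by (simp add: z)
      also have "norm \<dots> \<le> K * t ^ (N - 1)"
      proof (rule K(2))
        fix \<nu> assume "c \<nu> * dmonom z \<nu> j \<noteq> 0"
        from deg[OF this] show "N - 1 < tdeg \<nu>" using \<open>N > 0\<close> by simp
      qed (use t in \<open>auto simp: z\<close>)
      finally show ?thesis .
    qed
    obtain j where "norm (grad (ps_fun c) z) \<le> real CARD('n) * norm (grad (ps_fun c) z $ j)"
      using norm_le_card_max by blast
    also have "\<dots> \<le> real CARD('n) * (K * t ^ (N - 1))" by (intro mult_left_mono comp) auto
    finally show ?thesis by (simp add: z_def mult.assoc)
  qed
  show thesis
    by (rule that[of "real CARD('n) * K"], unfold eventually_at_right_field)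
       (use \<rho>(1) main in blast)
qed

section \<open>From gradient estimates to the exponent\<close>

text \<open>Members of \<open>loj_set\<close> must be positive while \<open>k\<close> may be 0, so
  \<open>k + e\<close> is used and \<open>e\<close> tends to 0. Inside the unit ball the larger
  exponent only weakens the bound, and at the origin \<open>0 powr (k + e)\<close> is 0.\<close>

lemma loj_exp_le:
  fixes g :: "complex^'n::finite \<Rightarrow> complex"
  assumes "C > 0" "eventually (\<lambda>z. C * norm z ^ k \<le> norm (grad g z)) (at 0)"
  shows "loj_exp g \<le> ereal (real k)"
proof (rule ereal_le_epsilon2)
  fix e :: real assume "e > 0"
  have "eventually (\<lambda>z::complex^'n. norm z < 1) (at 0)"
    unfolding eventually_at by (auto intro!: exI[of _ 1])
  with assms(2) have "eventually (\<lambda>z. C * norm z powr (real k + e) \<le> norm (grad g z)) (at 0)"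
  proof eventually_elim
    case (elim z)
    show ?case
    proof (cases "z = 0")
      case False
      hence "norm z powr (real k + e) \<le> norm z ^ k"
        using elim \<open>e > 0\<close> powr_mono'[of "real k" "real k + e" "norm z"] by (simp add: powr_realpow)
      hence "C * norm z powr (real k + e) \<le> C * norm z ^ k" using \<open>C > 0\<close> by simp
      thus ?thesis using elim by simp
    qed simp
  qed
  hence "eventually (\<lambda>z. C * norm z powr (real k + e) \<le> norm (grad g z)) (nhds 0)"
    unfolding eventually_at_filter by eventually_elim (use \<open>e > 0\<close> in auto)
  hence "real k + e \<in> loj_set g"
    using \<open>e > 0\<close> \<open>C > 0\<close> by (auto simp: loj_set_def)
  thus "loj_exp g \<le> ereal (real k) + ereal e"
    unfolding loj_exp_def by (auto intro!: Inf_lower)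
qed

lemma norm_axis: "norm (axis i x) = norm x"
proof -
  have "(\<Sum>j\<in>UNIV. (norm (axis i x $ j))\<^sup>2) = (\<Sum>j\<in>UNIV. if j = i then (norm x)\<^sup>2 else 0)"
    by (intro sum.cong) (auto simp: axis_def)
  thus ?thesis by (simp add: norm_vec_def L2_set_def)
qed

text \<open>Along the ray, a member \<open>\<theta>\<close> gives
  \<open>C * t powr \<theta> \<le> K * t ^ k\<close>. If \<open>\<theta> < k\<close>, dividing and
  letting \<open>t\<close> tend to 0 contradicts \<open>C > 0\<close>.\<close>

lemma loj_exp_ge:
  fixes g :: "complex^'n::finite \<Rightarrow> complex"
  assumes "eventually (\<lambda>t. norm (grad g (axis i (of_real t))) \<le> K * t ^ k) (at_right 0)"
  shows "ereal (real k) \<le> loj_exp g"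
  unfolding loj_exp_def
proof (rule Inf_greatest, safe)
  fix \<theta> assume "\<theta> \<in> loj_set g"
  then obtain C where C: "C > 0" "eventually (\<lambda>z. C * norm z powr \<theta> \<le> norm (grad g z)) (nhds 0)"
    by (auto simp: loj_set_def)
  have "((\<lambda>t. axis i (of_real t) :: complex^'n) \<longlongrightarrow> 0) (at_right 0)"
  proof (rule vec_tendstoI)
    have "((\<lambda>t. of_real t :: complex) \<longlongrightarrow> of_real 0) (at_right 0)"
      by (intro tendsto_intros)
    thus "((\<lambda>t. axis i (of_real t) $ l :: complex) \<longlongrightarrow> 0 $ l) (at_right 0)" for l
      by (cases "l = i") (simp_all add: axis_def)
  qed
  from eventually_compose_filterlim[OF C(2) this] assms
  have ev: "eventually (\<lambda>t. C * t powr \<theta> \<le> K * t ^ k \<and> 0 < t) (at_right 0)"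
    using eventually_at_right_less[of 0]
    by eventually_elim (auto simp: norm_axis)
  show "ereal (real k) \<le> ereal \<theta>"
  proof (rule ccontr)
    assume "\<not> ereal (real k) \<le> ereal \<theta>"
    hence "\<theta> < real k" by simp
    from ev have "eventually (\<lambda>t. C \<le> K * t powr (real k - \<theta>)) (at_right 0)"
    proof eventually_elim
      case (elim t)
      hence "C \<le> K * t ^ k / t powr \<theta>" by (simp add: pos_le_divide_eq)
      also have "\<dots> = K * t powr (real k - \<theta>)" using elim by (simp add: powr_diff powr_realpow)
      finally show ?case .
    qed
    moreover have "((\<lambda>t. K * t powr (real k - \<theta>)) \<longlongrightarrow> K * 0) (at_right 0)"
      using \<open>\<theta> < real k\<close> by (intro tendsto_mult tendsto_const tendsto_zero_powrI)
        (auto intro!: tendsto_eq_intros eventually_at_right_less eventually_mono[OF eventually_at_right_less[of 0]])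
    ultimately have "C \<le> K * 0" by (intro tendsto_lowerbound) auto
    thus False using C by simp
  qed
qed

theorem theorem6:
  fixes c :: "('n::finite \<Rightarrow> nat) \<Rightarrow> complex"
    and b :: "'n \<Rightarrow> real"
    and B :: real
  assumes "convergent_ps c"
    and "c (\<lambda>_. 0) = 0"
    and "non_degenerate c"
    and "convenient c"
    and "\<And>j. b j *\<^sub>R axis j 1 \<in> newton_boundary c"
    and "B = Max (range b)"
  shows "loj_exp (ps_fun c) \<le> ereal (B - 1) \<and>
         ((\<exists>i. b i = B \<and> \<not> loj_exceptional c B i) \<longrightarrow> loj_exp (ps_fun c) = ereal (B - 1))"
proof -
  \<comment> \<open>The real number \<open>b j\<close> is the exponent of the lowest pure power of
    \<open>z_j\<close> in the series.\<close>
  have "\<exists>m. b j = real m \<and> m > 0 \<and> c (axis_exp j m) \<noteq> 0 \<and> (\<forall>k<m. c (axis_exp j k) = 0)" for j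
    using newton_boundary_axis[OF assms(2) assms(5)[of j]] by metis
  then obtain m where m: "\<And>j. b j = real (m j)" "\<And>j. m j > 0" "\<And>j. c (axis_exp j (m j)) \<noteq> 0"
    "\<And>j k. k < m j \<Longrightarrow> c (axis_exp j k) = 0" by metis
  have "B \<in> range b" unfolding assms(6) by (rule Max_in) auto
  then obtain j0 where j0: "B = real (m j0)" using m(1) by auto
  define N where "N = m j0"
  have BN: "B = real N" "N > 0" using j0 m(2) by (auto simp: N_def)
  have "b j \<le> B" for j unfolding assms(6) by simp
  hence mN: "m j \<le> N" for j using m(1) BN by simp
  have BN1: "B - 1 = real (N - 1)" using BN by (simp add: of_nat_diff)
  obtain C where "C > 0" "eventually (\<lambda>z. C * norm z ^ (N - 1) \<le> norm (grad (ps_fun c) z)) (at 0)"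
    using grad_lower_bound[OF assms(1,3) m(3) mN BN(2)] .
  hence le: "loj_exp (ps_fun c) \<le> ereal (B - 1)" unfolding BN1 by (rule loj_exp_le)
  have "ereal (B - 1) \<le> loj_exp (ps_fun c)" if i: "b i = B" "\<not> loj_exceptional c B i" for i
  proof -
    have "m i = N" using i m(1) BN by simp
    moreover have "c (\<lambda>l. if l = j then 1 else if l = i then k else 0) = 0"
      if "j \<noteq> i" "Suc k < N" for j k
    proof -
      \<comment> \<open>Exceptionality, \<open>B' < B - 1\<close>, says exactly that the monomial
        \<open>z_j z_i^B'\<close> has degree below \<open>N\<close>.\<close>
      have "real k < B - 1" using that by (simp add: BN1)
      thus ?thesis using i(2) that(1) unfolding loj_exceptional_def by blast
    qed
    ultimately obtain K where
      "eventually (\<lambda>t. norm (grad (ps_fun c) (axis i (of_real t))) \<le> K * t ^ (N - 1)) (at_right 0)"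
      using grad_upper_bound_on_axis[OF assms(1), of N i] m(4) BN(2) by blast
    thus ?thesis unfolding BN1 by (rule loj_exp_ge)
  qed
  with le show ?thesis by (auto intro: antisym)
qed

end
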